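(* Let $K$ be the covariance kernel of a hermitian, centered, measurable complex second-order random field $\mathbb{G}$ on $\mathbb{R}^d$ such that $\int_{\mathbb{R}^d}K(t,t)\,\rho(dt)<\infty$. Let $I\subseteq\mathbb{N}$ and $(\alpha_i)_{i\in I}$ be the index set and eigenvalue sequence from Mercer's representation of $K$ (see context), and set $\mu^{(k)}:=\sum_{i\in I}\alpha_i^k$. Then for every $k\in\mathbb{N}$ $$\mu^{(k)}=\sum_{i\in I}\alpha_i^k=\int_{(\mathbb{R}^d)^k}\ \prod_{j=1}^{k-1}K\bigl(t^{(k-j+1)},t^{(k-j)}\bigr)\cdot K\bigl(t^{(1)},t^{(k)}\bigr)\ \rho^{\otimes k}(dt^{(1)},\dots,dt^{(k)}).$$ Moreover, $\mu^{(1)}<\infty$ implies $\mu^{(k)}<\infty$ for all $k\in\mathbb{N}$.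
   Context: Here $d\in\mathbb{N}$ and $\rho$ is a non-negative, symmetric ($\rho(A)=\rho(-A)$), $\sigma$-finite Borel measure on $\mathbb{R}^d$; $L^2(\rho)$ is the complex space $L^2(\mathbb{R}^d,\mathcal{B}(\mathbb{R}^d),\rho)$ with $\langle u,v\rangle=\int u\overline{v}\,d\rho$. A complex second-order random field is a map $\mathbb{G}:\mathbb{R}^d\to L^2(\Omega,\mathcal{A},\mathbb{P})$ (complex-valued square-integrable random variables); it is measurable if $(t,\omega)\mapsto\mathbb{G}(t)(\omega)$ is jointly measurable, centered if $\mathbb{E}(\mathbb{G}(t))=0$ for all $t$, and hermitian if $\mathbb{G}(-t)=\overline{\mathbb{G}(t)}$ for all $t$. Its covariance kernel (in the centered case) is $K(s,t)=\mathbb{E}(\mathbb{G}(s)\overline{\mathbb{G}(t)})$. Under $\int K(t,t)\,\rho(dt)<\infty$ the operator $T_K:L^2(\rho)\to L^2(\rho)$, $T_Ku=\int_{\mathbb{R}^d}K(\cdot,t)u(t)\,\rho(dt)$, is positive, compact and self-adjoint. Mercer's representation: there are an index set $I\subseteq\mathbb{N}$, a decreasing sequence $(\alpha_i)_{i\in I}$ of positive, not necessarily distinct, real numbers (the positive eigenvalues of $T_K$ counted with multiplicity) and an orthonormal system $(e_i)_{i\in I}$ in $L^2(\rho)$ with $T_Ke_i=\alpha_ie_i$, closed span of $\{e_i\}$ equal to the closure of the range of $T_K$, and $K(s,t)=\sum_{i\in I}\alpha_ie_i(s)\overline{e_i(t)}$ for $\rho\otimes\rho$-almost all $(s,t)$.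 An empty product equals $1$. *)

theory Defs
  imports "HOL-Probability.Probability"
begin

text \<open>
  Elements of a complex \<open>L\<^sup>2\<close> space are represented by functions, and equality in
  \<open>L\<^sup>2\<close> is equality almost everywhere.
\<close>

definition l2 :: "'a measure \<Rightarrow> ('a \<Rightarrow> complex) set" where
  "l2 M = {u \<in> borel_measurable M. integrable M (\<lambda>x. (cmod (u x))\<^sup>2)}"

definition l2_inner :: "'a measure \<Rightarrow> ('a \<Rightarrow> complex) \<Rightarrow> ('a \<Rightarrow> complex) \<Rightarrow> complex" where
  "l2_inner M u v = (\<integral>x. u x * cnj (v x) \<partial>M)"

definition l2_norm :: "'a measure \<Rightarrow> ('a \<Rightarrow> complex) \<Rightarrow> real" where
  "l2_norm M u = sqrt (\<integral>x. (cmod (u x))\<^sup>2 \<partial>M)"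

definition l2_closure :: "'a measure \<Rightarrow> ('a \<Rightarrow> complex) set \<Rightarrow> ('a \<Rightarrow> complex) set" where
  "l2_closure M S = {u \<in> l2 M. \<forall>\<epsilon>>0. \<exists>v\<in>S. l2_norm M (\<lambda>x. u x - v x) < \<epsilon>}"

definition lin_span :: "(nat \<Rightarrow> 'a \<Rightarrow> complex) \<Rightarrow> nat set \<Rightarrow> ('a \<Rightarrow> complex) set" where
  "lin_span e J = {(\<lambda>x. \<Sum>i\<in>F. c i * e i x) | F c. finite F \<and> F \<subseteq> J}"

definition orthonormal_system ::
    "'a measure \<Rightarrow> nat set \<Rightarrow> (nat \<Rightarrow> 'a \<Rightarrow> complex) \<Rightarrow> bool" where
  "orthonormal_system M I e \<longleftrightarrow>
     (\<forall>i\<in>I. e i \<in> l2 M) \<and>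
     (\<forall>i\<in>I. \<forall>j\<in>I. l2_inner M (e i) (e j) = (if i = j then 1 else 0))"

definition symmetric_measure :: "'a::{group_add,topological_space} measure \<Rightarrow> bool" where
  "symmetric_measure \<rho> \<longleftrightarrow> (\<forall>A\<in>sets borel. emeasure \<rho> (uminus ` A) = emeasure \<rho> A)"

definition second_order_field :: "'w measure \<Rightarrow> ('a \<Rightarrow> 'w \<Rightarrow> complex) \<Rightarrow> bool" where
  "second_order_field P G \<longleftrightarrow> (\<forall>t. G t \<in> l2 P)"

definition measurable_field ::
    "'w measure \<Rightarrow> ('a::topological_space \<Rightarrow> 'w \<Rightarrow> complex) \<Rightarrow> bool" where
  "measurable_field P G \<longleftrightarrow> (\<lambda>(t, \<omega>). G t \<omega>) \<in> borel_measurable (borel \<Otimes>\<^sub>M P)"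

definition centered_field :: "'w measure \<Rightarrow> ('a \<Rightarrow> 'w \<Rightarrow> complex) \<Rightarrow> bool" where
  "centered_field P G \<longleftrightarrow> (\<forall>t. (\<integral>\<omega>. G t \<omega> \<partial>P) = 0)"

definition hermitian_field ::
    "'w measure \<Rightarrow> ('a::group_add \<Rightarrow> 'w \<Rightarrow> complex) \<Rightarrow> bool" where
  "hermitian_field P G \<longleftrightarrow> (\<forall>t. AE \<omega> in P. G (- t) \<omega> = cnj (G t \<omega>))"

text \<open>The covariance kernel of a centered field.\<close>

definition cov_kernel :: "'w measure \<Rightarrow> ('a \<Rightarrow> 'w \<Rightarrow> complex) \<Rightarrow> 'a \<Rightarrow> 'a \<Rightarrow> complex" where
  "cov_kernel P G s t = (\<integral>\<omega>. G s \<omega> * cnj (G t \<omega>) \<partial>P)"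

definition integral_op ::
    "'a measure \<Rightarrow> ('a \<Rightarrow> 'a \<Rightarrow> complex) \<Rightarrow> ('a \<Rightarrow> complex) \<Rightarrow> 'a \<Rightarrow> complex" where
  "integral_op \<rho> K u = (\<lambda>s. \<integral>t. K s t * u t \<partial>\<rho>)"

text \<open>
  The fifth conjunct expresses that the \<open>\<alpha> i\<close> exhaust the positive eigenvalues of the
  integral operator, counted with multiplicity: the \<open>e i\<close> with \<open>\<alpha> i = l\<close>, which are
  linearly independent by orthonormality, span the whole eigenspace of \<open>l\<close> (all these
  eigenspaces are finite-dimensional, the operator being compact).
\<close>

definition mercer_representation ::
    "'a measure \<Rightarrow> ('a \<Rightarrow> 'a \<Rightarrow> complex) \<Rightarrow> nat set \<Rightarrow> (nat \<Rightarrow> real) \<Rightarrow>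
     (nat \<Rightarrow> 'a \<Rightarrow> complex) \<Rightarrow> bool" where
  "mercer_representation \<rho> K I \<alpha> e \<longleftrightarrow>
     (\<forall>i\<in>I. 0 < \<alpha> i) \<and>
     (\<forall>i\<in>I. \<forall>j\<in>I. i \<le> j \<longrightarrow> \<alpha> j \<le> \<alpha> i) \<and>
     orthonormal_system \<rho> I e \<and>
     (\<forall>i\<in>I. AE s in \<rho>. integral_op \<rho> K (e i) s = complex_of_real (\<alpha> i) * e i s) \<and>
     (\<forall>l>0. \<forall>u\<in>l2 \<rho>. (AE s in \<rho>. integral_op \<rho> K u s = complex_of_real l * u s) \<longrightarrow>
        (\<exists>v\<in>lin_span e {i\<in>I. \<alpha> i = l}. AE s in \<rho>. u s = v s)) \<and>
     l2_closure \<rho> (lin_span e I) = l2_closure \<rho> (integral_op \<rho> K ` l2 \<rho>) \<and>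
     (AE (s, t) in \<rho> \<Otimes>\<^sub>M \<rho>.
        ((\<lambda>i. complex_of_real (\<alpha> i) * e i s * cnj (e i t)) has_sum K s t) I)"

text \<open>Extended-real valued, since the sum may a priori diverge.\<close>

definition eigen_power_sum :: "nat set \<Rightarrow> (nat \<Rightarrow> real) \<Rightarrow> nat \<Rightarrow> ennreal" where
  "eigen_power_sum I \<alpha> k = (\<Sum>\<^sub>\<infinity>i\<in>I. ennreal (\<alpha> i ^ k))"

definition cyclic_kernel_product ::
    "('a \<Rightarrow> 'a \<Rightarrow> complex) \<Rightarrow> nat \<Rightarrow> (nat \<Rightarrow> 'a) \<Rightarrow> complex" where
  "cyclic_kernel_product K k t =
     (\<Prod>j\<in>{1..k-1}. K (t (k - j + 1)) (t (k - j))) * K (t 1) (t k)"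

end

(*
  The truncated Karhunen-Loeve residual R_N = G - sum_{i in I, i < N} e_i(t) c_i(w), where
  c_i = <G(.,w), e_i>, has covariance K - K_N with K_N the N-th partial sum of the Mercer series,
  so Cauchy-Schwarz gives |K - K_N|(s,t) <= sqrt (K - K_N)(s,s) * sqrt (K - K_N)(t,t). Mercer's
  series is only assumed to converge almost everywhere on the product, which says nothing about the
  diagonal. The diagonal is reached through G: the R_N are Cauchy in L2(rho x P), their integrals
  over rectangles tend to 0 by the Mercer expansion, hence their limit is 0. This is the trace
  formula, and it yields K_N -> K at (s,t) for all s, t outside a rho-null set. The k-fold integral
  is then a limit of finite-rank ones by dominated convergence; in those, orthonormality kills all
  index tuples that are not constant.
*)

theory Submission
  imports Defs
begin

section \<open>Complex square-integrable functions\<close>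

text \<open>The obstacle is the diagonal: for k = 1 the cyclic product is K(t, t), and a null set of
  pairs (s, t) may well contain all pairs (t, t). The bridge is the map \<open>proj\<close> from
  L2(\<rho>) to L2(P), a conjugate linear square root of T_K: <G(s), proj u> = (T_K u)(s). Hence the
  c_i are orthogonal with squared norms \<alpha>_i, and e_i(s) is the coefficient of G(s) along c_i
  wherever the eigenvalue equation holds at s. Existence of the limit of R_N: the squared distance
  of R_N and R_M is the sum of the \<alpha>_i between N and M, and all these sums are bounded by the
  trace because K_N(t, t) <= K(t, t). Its vanishing: R_N integrated against u in t is a random
  variable whose squared norm is the integral of (K - K_N)(s, t) cnj u(s) u(t) over pairs, and an
  integral over pairs does not see the diagonal.\<close>

lemma borel_measurable_cnj [measurable (raw)]:
  assumes "f \<in> borel_measurable M"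
  shows "(\<lambda>x. cnj (f x)) \<in> borel_measurable M"
  using measurable_compose[OF assms borel_measurable_continuous_onI[of cnj]]
  by (simp add: continuous_on_cnj)

lemma l2D:
  assumes "u \<in> l2 M"
  shows "u \<in> borel_measurable M" and "integrable M (\<lambda>x. (cmod (u x))\<^sup>2)"
  using assms by (auto simp: l2_def)

lemma integrable_norm_mult_l2:
  assumes u: "u \<in> l2 M" and v: "v \<in> l2 M"
  shows "integrable M (\<lambda>x. cmod (u x) * cmod (v x))"
proof (rule Bochner_Integration.integrable_bound)
  note [measurable] = l2D(1)[OF u] l2D(1)[OF v]
  show "integrable M (\<lambda>x. (cmod (u x))\<^sup>2 + (cmod (v x))\<^sup>2)"
    using l2D(2)[OF u] l2D(2)[OF v] by simp
  show "(\<lambda>x. cmod (u x) * cmod (v x)) \<in> borel_measurable M" by measurable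
  show "AE x in M. norm (cmod (u x) * cmod (v x)) \<le> norm ((cmod (u x))\<^sup>2 + (cmod (v x))\<^sup>2)"
  proof (rule AE_I2)
    fix x
    have "2 * (cmod (u x) * cmod (v x)) \<le> (cmod (u x))\<^sup>2 + (cmod (v x))\<^sup>2"
      using sum_squares_bound[of "cmod (u x)" "cmod (v x)"] by (simp add: mult.assoc)
    moreover have "0 \<le> cmod (u x) * cmod (v x)" by simp
    ultimately show "norm (cmod (u x) * cmod (v x)) \<le> norm ((cmod (u x))\<^sup>2 + (cmod (v x))\<^sup>2)"
      by (smt (verit) real_norm_def)
  qed
qed

lemma integrable_mult_cnj_l2:
  assumes u: "u \<in> l2 M" and v: "v \<in> l2 M"
  shows "integrable M (\<lambda>x. u x * cnj (v x))"
proof (rule Bochner_Integration.integrable_bound[OF integrable_norm_mult_l2[OF u v]])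
  note [measurable] = l2D(1)[OF u] l2D(1)[OF v]
  show "(\<lambda>x. u x * cnj (v x)) \<in> borel_measurable M" by measurable
qed (simp add: norm_mult)

lemma l2_zero [simp]: "(\<lambda>x. 0) \<in> l2 M"
  by (simp add: l2_def)

lemma l2_cmult:
  assumes u: "u \<in> l2 M"
  shows "(\<lambda>x. a * u x) \<in> l2 M"
proof -
  note [measurable] = l2D(1)[OF u]
  have "integrable M (\<lambda>x. (cmod a)\<^sup>2 * (cmod (u x))\<^sup>2)"
    using l2D(2)[OF u] by simp
  then show ?thesis by (simp add: l2_def norm_mult power_mult_distrib)
qed

lemma l2_add:
  assumes u: "u \<in> l2 M" and v: "v \<in> l2 M"
  shows "(\<lambda>x. u x + v x) \<in> l2 M"
proof -
  note [measurable] = l2D(1)[OF u] l2D(1)[OF v]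
  have "integrable M (\<lambda>x. (cmod (u x + v x))\<^sup>2)"
  proof (rule Bochner_Integration.integrable_bound)
    show "integrable M (\<lambda>x. (cmod (u x))\<^sup>2 + (cmod (v x))\<^sup>2 + 2 * (cmod (u x) * cmod (v x)))"
      using l2D(2)[OF u] l2D(2)[OF v] integrable_norm_mult_l2[OF u v] by simp
    show "AE x in M. norm ((cmod (u x + v x))\<^sup>2)
        \<le> norm ((cmod (u x))\<^sup>2 + (cmod (v x))\<^sup>2 + 2 * (cmod (u x) * cmod (v x)))"
    proof (rule AE_I2)
      fix x
      have "(cmod (u x + v x))\<^sup>2 \<le> (cmod (u x) + cmod (v x))\<^sup>2"
        by (intro power_mono norm_triangle_ineq) simp
      then show "norm ((cmod (u x + v x))\<^sup>2)
          \<le> norm ((cmod (u x))\<^sup>2 + (cmod (v x))\<^sup>2 + 2 * (cmod (u x) * cmod (v x)))"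
        by (simp add: power2_sum)
    qed
  qed measurable
  then show ?thesis by (simp add: l2_def)
qed

lemma l2_diff:
  assumes "u \<in> l2 M" and "v \<in> l2 M"
  shows "(\<lambda>x. u x - v x) \<in> l2 M"
  using l2_add[OF assms(1) l2_cmult[OF assms(2), of "-1"]] by simp

lemma l2_sum:
  assumes "\<And>i. i \<in> F \<Longrightarrow> u i \<in> l2 M"
  shows "(\<lambda>x. \<Sum>i\<in>F. u i x) \<in> l2 M"
  using assms by (induction F rule: infinite_finite_induct) (auto intro: l2_add)

lemma l2_inner_commute: "l2_inner M v u = cnj (l2_inner M u v)"
  unfolding l2_inner_def by (subst Bochner_Integration.integral_cnj[symmetric]) (simp add: mult.commute)

lemma l2_inner_self: "l2_inner M u u = complex_of_real (\<integral>x. (cmod (u x))\<^sup>2 \<partial>M)"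
  unfolding l2_inner_def complex_norm_square[symmetric] by (rule integral_complex_of_real)

lemma l2_inner_diff_left:
  assumes "u \<in> l2 M" "v \<in> l2 M" "w \<in> l2 M"
  shows "l2_inner M (\<lambda>x. u x - v x) w = l2_inner M u w - l2_inner M v w"
  unfolding l2_inner_def left_diff_distrib
  using assms by (intro Bochner_Integration.integral_diff integrable_mult_cnj_l2)

lemma l2_inner_diff_right:
  assumes "u \<in> l2 M" "v \<in> l2 M" "w \<in> l2 M"
  shows "l2_inner M w (\<lambda>x. u x - v x) = l2_inner M w u - l2_inner M w v"
  unfolding l2_inner_commute[of M w] l2_inner_diff_left[OF assms] by simp

lemma l2_inner_sum_left:
  assumes "\<And>i. i \<in> F \<Longrightarrow> u i \<in> l2 M" "w \<in> l2 M"
  shows "l2_inner M (\<lambda>x. \<Sum>i\<in>F. a i * u i x) w = (\<Sum>i\<in>F. a i * l2_inner M (u i) w)"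
proof -
  have "l2_inner M (\<lambda>x. \<Sum>i\<in>F. a i * u i x) w = (\<integral>x. (\<Sum>i\<in>F. a i * (u i x * cnj (w x))) \<partial>M)"
    by (simp add: l2_inner_def sum_distrib_right mult.assoc)
  also have "\<dots> = (\<Sum>i\<in>F. \<integral>x. a i * (u i x * cnj (w x)) \<partial>M)"
    using assms by (intro Bochner_Integration.integral_sum integrable_mult_right integrable_mult_cnj_l2)
  also have "\<dots> = (\<Sum>i\<in>F. a i * l2_inner M (u i) w)"
    by (simp add: l2_inner_def)
  finally show ?thesis .
qed

lemma l2_inner_sum_right:
  assumes "\<And>i. i \<in> F \<Longrightarrow> u i \<in> l2 M" "w \<in> l2 M"
  shows "l2_inner M w (\<lambda>x. \<Sum>i\<in>F. a i * u i x) = (\<Sum>i\<in>F. cnj (a i) * l2_inner M w (u i))"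
proof -
  have "l2_inner M w (\<lambda>x. \<Sum>i\<in>F. a i * u i x) = cnj (\<Sum>i\<in>F. a i * l2_inner M (u i) w)"
    by (subst l2_inner_commute) (use assms in \<open>simp add: l2_inner_sum_left\<close>)
  also have "\<dots> = (\<Sum>i\<in>F. cnj (a i) * l2_inner M w (u i))"
    by (simp add: l2_inner_commute[of M w])
  finally show ?thesis .
qed

section \<open>Cauchy-Schwarz and Gram identities\<close>

lemma nonneg_quadratic_bound:
  fixes A B C :: real
  assumes nonneg: "\<And>x. 0 \<le> A - 2 * x * B + x\<^sup>2 * C" and "0 \<le> C"
  shows "B\<^sup>2 \<le> A * C"
proof (cases "C = 0")
  case True
  have "B = 0"
  proof (rule ccontr)
    assume "B \<noteq> 0"
    \<comment> \<open>With C = 0 the expression is affine in x, and this x gives it the value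
      -1.\<close>
    then show False using nonneg[of "(A + 1) / (2 * B)"] True by simp
  qed
  then show ?thesis using True by simp
next
  case False
  then have "0 < C" using \<open>0 \<le> C\<close> by simp
  \<comment> \<open>B / C is the minimiser of the quadratic.\<close>
  have "A - 2 * (B / C) * B + (B / C)\<^sup>2 * C = A - B\<^sup>2 / C"
    using False by (simp add: field_simps power2_eq_square)
  then have "0 \<le> A - B\<^sup>2 / C" using nonneg[of "B / C"] by simp
  then show ?thesis using \<open>0 < C\<close> by (simp add: field_simps)
qed

text \<open>With moduli the quadratic has a real variable and real coefficients. The bound on the L1
  norm of the product, stronger than one on the inner product, is what later turns L2 distances into
  L1 distances.\<close>

lemma l2_Cauchy_Schwarz_norm:
  assumes u: "u \<in> l2 M" and v: "v \<in> l2 M"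
  shows "(\<integral>x. cmod (u x) * cmod (v x) \<partial>M)
    \<le> sqrt (\<integral>x. (cmod (u x))\<^sup>2 \<partial>M) * sqrt (\<integral>x. (cmod (v x))\<^sup>2 \<partial>M)"
proof -
  let ?A = "\<integral>x. (cmod (u x))\<^sup>2 \<partial>M" and ?B = "\<integral>x. cmod (u x) * cmod (v x) \<partial>M"
    and ?C = "\<integral>x. (cmod (v x))\<^sup>2 \<partial>M"
  have "?B\<^sup>2 \<le> ?A * ?C"
  proof (rule nonneg_quadratic_bound)
    fix y :: real
    have "0 \<le> (\<integral>x. (cmod (u x) - y * cmod (v x))\<^sup>2 \<partial>M)" by simp
    also have "\<dots> = (\<integral>x. ((cmod (u x))\<^sup>2 - 2 * y * (cmod (u x) * cmod (v x))) + y\<^sup>2 * (cmod (v x))\<^sup>2 \<partial>M)"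
      by (simp add: power2_diff power_mult_distrib algebra_simps)
    also have "\<dots> = ?A - 2 * y * ?B + y\<^sup>2 * ?C"
      using l2D(2)[OF u] l2D(2)[OF v] integrable_norm_mult_l2[OF u v] by simp
    finally show "0 \<le> ?A - 2 * y * ?B + y\<^sup>2 * ?C" .
  qed simp
  then have "sqrt (?B\<^sup>2) \<le> sqrt (?A * ?C)" by (rule real_sqrt_le_mono)
  then show ?thesis by (simp add: real_sqrt_mult)
qed

lemma l2_Cauchy_Schwarz:
  assumes u: "u \<in> l2 M" and v: "v \<in> l2 M"
  shows "cmod (l2_inner M u v) \<le> sqrt (Re (l2_inner M u u)) * sqrt (Re (l2_inner M v v))"
proof -
  have "cmod (l2_inner M u v) \<le> (\<integral>x. cmod (u x * cnj (v x)) \<partial>M)"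
    unfolding l2_inner_def by (rule integral_norm_bound)
  also have "\<dots> \<le> sqrt (Re (l2_inner M u u)) * sqrt (Re (l2_inner M v v))"
    using l2_Cauchy_Schwarz_norm[OF u v] by (simp add: norm_mult l2_inner_self)
  finally show ?thesis .
qed

lemma Re_l2_inner_self_nonneg: "0 \<le> Re (l2_inner M u u)"
  by (simp add: l2_inner_self)

text \<open>The c i are orthogonal, and a i = <Y, c i> / \<alpha> i is the coefficient of the
  orthogonal projection of Y. Both mixed terms and the term of the two sums therefore coincide, and
  one copy is left with a minus sign. Used with Y = G(s), a i = e i s, and with Y =
  \<open>proj u\<close>, a i = <e i, u>.\<close>

lemma l2_inner_residual:
  assumes F: "finite F" and Y: "Y \<in> l2 M" "Y' \<in> l2 M" and c: "\<And>i. i \<in> F \<Longrightarrow> c i \<in> l2 M"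
    and Yc: "\<And>i. i \<in> F \<Longrightarrow> l2_inner M Y (c i) = complex_of_real (\<alpha> i) * a i"
    and Yc': "\<And>i. i \<in> F \<Longrightarrow> l2_inner M Y' (c i) = complex_of_real (\<alpha> i) * b i"
    and cc: "\<And>i j. i \<in> F \<Longrightarrow> j \<in> F \<Longrightarrow>
      l2_inner M (c i) (c j) = (if i = j then complex_of_real (\<alpha> i) else 0)"
  shows "l2_inner M (\<lambda>x. Y x - (\<Sum>i\<in>F. a i * c i x)) (\<lambda>x. Y' x - (\<Sum>i\<in>F. b i * c i x))
    = l2_inner M Y Y' - (\<Sum>i\<in>F. complex_of_real (\<alpha> i) * a i * cnj (b i))"
proof -
  let ?S = "\<lambda>x. \<Sum>i\<in>F. a i * c i x" and ?S' = "\<lambda>x. \<Sum>i\<in>F. b i * c i x"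
  have S: "?S \<in> l2 M" "?S' \<in> l2 M" using c by (auto intro!: l2_sum l2_cmult)
  have "l2_inner M (c i) ?S' = complex_of_real (\<alpha> i) * cnj (b i)" if "i \<in> F" for i
  proof -
    have "l2_inner M (c i) ?S' = (\<Sum>j\<in>F. cnj (b j) * l2_inner M (c i) (c j))"
      by (rule l2_inner_sum_right) (use c that in auto)
    also have "\<dots> = (\<Sum>j\<in>F. if j = i then cnj (b i) * complex_of_real (\<alpha> i) else 0)"
      using that by (intro sum.cong) (auto simp: cc)
    finally show ?thesis using F that by (simp add: mult.commute)
  qed
  then have SS: "l2_inner M ?S ?S' = (\<Sum>i\<in>F. complex_of_real (\<alpha> i) * a i * cnj (b i))"
    using c S by (simp add: l2_inner_sum_left mult_ac)
  have cY': "l2_inner M (c i) Y' = complex_of_real (\<alpha> i) * cnj (b i)" if "i \<in> F" for i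
    using Yc'[OF that] by (subst l2_inner_commute) simp
  have SY: "l2_inner M ?S Y' = (\<Sum>i\<in>F. complex_of_real (\<alpha> i) * a i * cnj (b i))"
    using c Y cY' by (simp add: l2_inner_sum_left mult_ac)
  have YS: "l2_inner M Y ?S' = (\<Sum>i\<in>F. complex_of_real (\<alpha> i) * a i * cnj (b i))"
    using c Y by (simp add: l2_inner_sum_right Yc mult_ac)
  have "l2_inner M (\<lambda>x. Y x - ?S x) (\<lambda>x. Y' x - ?S' x)
    = (l2_inner M Y Y' - l2_inner M Y ?S') - (l2_inner M ?S Y' - l2_inner M ?S ?S')"
    using Y S by (simp add: l2_inner_diff_left l2_inner_diff_right l2_diff)
  then show ?thesis by (simp add: SS SY YS)
qed

lemma l2_inner_orthogonal_sum:
  assumes F: "finite F" and c: "\<And>i. i \<in> F \<Longrightarrow> c i \<in> l2 M"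
    and cc: "\<And>i j. i \<in> F \<Longrightarrow> j \<in> F \<Longrightarrow>
      l2_inner M (c i) (c j) = (if i = j then complex_of_real (\<alpha> i) else 0)"
  shows "l2_inner M (\<lambda>x. \<Sum>i\<in>F. a i * c i x) (\<lambda>x. \<Sum>i\<in>F. a i * c i x)
    = (\<Sum>i\<in>F. complex_of_real (\<alpha> i * (cmod (a i))\<^sup>2))"
proof -
  have "l2_inner M (c i) (\<lambda>x. \<Sum>j\<in>F. a j * c j x) = complex_of_real (\<alpha> i) * cnj (a i)"
    if "i \<in> F" for i
  proof -
    have "l2_inner M (c i) (\<lambda>x. \<Sum>j\<in>F. a j * c j x) = (\<Sum>j\<in>F. cnj (a j) * l2_inner M (c i) (c j))"
      by (rule l2_inner_sum_right) (use c that in auto)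
    also have "\<dots> = (\<Sum>j\<in>F. if j = i then cnj (a i) * complex_of_real (\<alpha> i) else 0)"
      using that by (intro sum.cong) (auto simp: cc)
    finally show ?thesis using F that by (simp add: mult.commute)
  qed
  then show ?thesis
    using c by (simp add: l2_inner_sum_left l2_sum l2_cmult complex_norm_square mult_ac
      del: of_real_power)
qed

section \<open>Integrals over product measures\<close>

lemma (in pair_sigma_finite) integrable_pair_mult:
  fixes f :: "'a \<Rightarrow> 'c::{real_normed_field, banach, second_countable_topology}"
  assumes f: "integrable M1 f" and g: "integrable M2 g"
  shows "integrable (M1 \<Otimes>\<^sub>M M2) (\<lambda>(x, y). f x * g y)"
proof (rule Fubini_integrable)
  note [measurable] = borel_measurable_integrable[OF f] borel_measurable_integrable[OF g]
  show "(\<lambda>(x, y). f x * g y) \<in> borel_measurable (M1 \<Otimes>\<^sub>M M2)" by measurable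
qed (use f g in \<open>simp_all add: norm_mult\<close>)

text \<open>Dynkin's lemma: the sets over which the integral vanishes form a \<open>\<lambda>\<close>-system.\<close>

lemma (in pair_sigma_finite) AE_zero_if_integral_rectangles_zero:
  fixes f :: "'a \<times> 'b \<Rightarrow> 'c::{banach, second_countable_topology}"
  assumes f: "integrable (M1 \<Otimes>\<^sub>M M2) f"
    and rect: "\<And>A B. A \<in> sets M1 \<Longrightarrow> B \<in> sets M2 \<Longrightarrow> (LINT z:A \<times> B|M1 \<Otimes>\<^sub>M M2. f z) = 0"
  shows "AE z in M1 \<Otimes>\<^sub>M M2. f z = 0"
proof -
  let ?MN = "M1 \<Otimes>\<^sub>M M2"
  let ?E = "{a \<times> b | a b. a \<in> sets M1 \<and> b \<in> sets N}"
  have int: "set_integrable ?MN C f" if "C \<in> sets ?MN" for C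
    using f that unfolding set_integrable_def by (rule integrable_mult_indicator[rotated])
  have "(LINT z:C|?MN. f z) = 0" if "C \<in> sets ?MN" for C
    using Int_stable_pair_measure_generator pair_measure_closed that unfolding sets_pair_measure
  proof (induct rule: sigma_sets_induct_disjoint)
    case (basic C)
    then show ?case using rect by auto
  next
    case empty
    then show ?case by (simp add: set_lebesgue_integral_def)
  next
    case (compl C)
    have C: "C \<in> sets ?MN" using compl(1) by (simp add: sets_pair_measure)
    have C': "space ?MN - C \<in> sets ?MN" using C by auto
    have "(LINT z:C \<union> (space ?MN - C)|?MN. f z) = (LINT z:C|?MN. f z) + (LINT z:space ?MN - C|?MN. f z)"
      by (rule set_integral_Un) (use C C' int in auto)
    moreover have "C \<union> (space ?MN - C) = space M1 \<times> space M2"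
      using sets.sets_into_space[OF C] by (auto simp: space_pair_measure)
    ultimately show ?case using compl(2) rect[of "space M1" "space M2"]
      by (simp add: space_pair_measure)
  next
    case (union C)
    have C: "C i \<in> sets ?MN" for i using union(2) by (auto simp: sets_pair_measure)
    have "(LINT z:(\<Union>i. C i)|?MN. f z) = (\<Sum>i. LINT z:C i|?MN. f z)"
      by (rule lebesgue_integral_countable_add)
        (use C union(1) int in \<open>auto simp: disjoint_family_on_def\<close>)
    then show ?case using union(3) by simp
  qed
  then show ?thesis
    using f by (intro P.density_unique_banach[of f "\<lambda>_. 0"]) (auto simp: set_lebesgue_integral_def)
qed

section \<open>Measurable second-order fields\<close>

text \<open>By Tonelli, \<open>integrable_variance\<close> says that G is square integrable over the
  product of \<rho> and P, the space in which the residuals converge.\<close>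

locale l2_field =
  index: sigma_finite_measure \<rho> + prob: prob_space P
  for \<rho> :: "'a measure" and P :: "'w measure" +
  fixes G :: "'a \<Rightarrow> 'w \<Rightarrow> complex"
  assumes measurable_field [measurable]: "(\<lambda>(t, \<omega>). G t \<omega>) \<in> borel_measurable (\<rho> \<Otimes>\<^sub>M P)"
    and field_l2: "G t \<in> l2 P"
    and integrable_variance: "integrable \<rho> (\<lambda>t. Re (cov_kernel P G t t))"
begin

sublocale pair_sigma_finite \<rho> P ..

sublocale index_pair: pair_sigma_finite \<rho> \<rho> ..

abbreviation "K \<equiv> cov_kernel P G"

lemma cov_kernel_eq_inner: "K s t = l2_inner P (G s) (G t)"
  by (simp add: cov_kernel_def l2_inner_def)

lemma Re_cov_kernel_diag: "Re (K t t) = (\<integral>\<omega>. (cmod (G t \<omega>))\<^sup>2 \<partial>P)"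
  by (simp add: cov_kernel_eq_inner l2_inner_self)

lemma variance_nonneg: "0 \<le> Re (K t t)"
  by (simp add: Re_cov_kernel_diag)

lemma measurable_cov_kernel [measurable]: "(\<lambda>(s, t). K s t) \<in> borel_measurable (\<rho> \<Otimes>\<^sub>M \<rho>)"
proof -
  have "(\<lambda>z. (\<lambda>(t, \<omega>). G t \<omega>) (fst (fst z), snd z)) \<in> borel_measurable ((\<rho> \<Otimes>\<^sub>M \<rho>) \<Otimes>\<^sub>M P)"
    by (rule measurable_compose[OF _ measurable_field]) measurable
  moreover have "(\<lambda>z. (\<lambda>(t, \<omega>). G t \<omega>) (snd (fst z), snd z)) \<in> borel_measurable ((\<rho> \<Otimes>\<^sub>M \<rho>) \<Otimes>\<^sub>M P)"
    by (rule measurable_compose[OF _ measurable_field]) measurable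
  ultimately have "(\<lambda>z. G (fst (fst z)) (snd z) * cnj (G (snd (fst z)) (snd z)))
      \<in> borel_measurable ((\<rho> \<Otimes>\<^sub>M \<rho>) \<Otimes>\<^sub>M P)"
    by simp
  then show ?thesis
    unfolding cov_kernel_def split_def
    by (intro prob.borel_measurable_lebesgue_integral) (simp add: split_def)
qed

lemma measurable_cov_kernel_compose [measurable (raw)]:
  assumes "f \<in> measurable N \<rho>" "g \<in> measurable N \<rho>"
  shows "(\<lambda>x. K (f x) (g x)) \<in> borel_measurable N"
  using measurable_compose[OF measurable_Pair[OF assms] measurable_cov_kernel] by simp

lemma norm_cov_kernel_le: "cmod (K s t) \<le> sqrt (Re (K s s)) * sqrt (Re (K t t))"
  using l2_Cauchy_Schwarz[OF field_l2 field_l2] by (simp add: cov_kernel_eq_inner)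

lemma field_l2_pair: "(\<lambda>(t, \<omega>). G t \<omega>) \<in> l2 (\<rho> \<Otimes>\<^sub>M P)"
proof -
  have "integrable (\<rho> \<Otimes>\<^sub>M P) (\<lambda>z. (cmod (G (fst z) (snd z)))\<^sup>2)"
    by (rule Fubini_integrable)
      (use l2D(2)[OF field_l2] integrable_variance in \<open>simp_all add: Re_cov_kernel_diag\<close>)
  then show ?thesis by (simp add: l2_def split_def)
qed

lemma mult_l2_pair:
  assumes u: "u \<in> l2 \<rho>" and Y: "Y \<in> l2 P"
  shows "(\<lambda>(t, \<omega>). u t * Y \<omega>) \<in> l2 (\<rho> \<Otimes>\<^sub>M P)"
proof -
  note [measurable] = l2D(1)[OF u] l2D(1)[OF Y]
  have "integrable (\<rho> \<Otimes>\<^sub>M P) (\<lambda>(t, \<omega>). (cmod (u t))\<^sup>2 * (cmod (Y \<omega>))\<^sup>2)"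
    by (rule integrable_pair_mult[OF l2D(2)[OF u] l2D(2)[OF Y]])
  then show ?thesis by (simp add: l2_def split_def norm_mult power_mult_distrib)
qed

lemma AE_field_l2: "AE \<omega> in P. (\<lambda>t. G t \<omega>) \<in> l2 \<rho>"
proof -
  have "integrable (\<rho> \<Otimes>\<^sub>M P) (\<lambda>(t, \<omega>). (cmod (G t \<omega>))\<^sup>2)"
    using l2D(2)[OF field_l2_pair] by (simp add: split_def)
  from AE_integrable_snd[OF this] AE_space show ?thesis
    by eventually_elim (simp add: l2_def)
qed

text \<open>The coefficient of the path along u, conjugate linear in u. It is total: at an \<omega>
  whose path is not integrable against the conjugate of u it is 0, the default of the Bochner
  integral.\<close>

definition proj :: "('a \<Rightarrow> complex) \<Rightarrow> 'w \<Rightarrow> complex" where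
  "proj u \<omega> = l2_inner \<rho> (\<lambda>t. G t \<omega>) u"

lemma proj_l2:
  assumes u: "u \<in> l2 \<rho>"
  shows "proj u \<in> l2 P"
proof -
  note [measurable] = l2D(1)[OF u]
  have m [measurable]: "proj u \<in> borel_measurable P"
    unfolding proj_def l2_inner_def by measurable
  have int: "integrable (\<rho> \<Otimes>\<^sub>M P) (\<lambda>(t, \<omega>). (cmod (G t \<omega>))\<^sup>2)"
    using l2D(2)[OF field_l2_pair] by (simp add: split_def)
  have "integrable P (\<lambda>\<omega>. (cmod (proj u \<omega>))\<^sup>2)"
  proof (rule Bochner_Integration.integrable_bound)
    show "integrable P (\<lambda>\<omega>. (\<integral>t. (cmod (G t \<omega>))\<^sup>2 \<partial>\<rho>) * (\<integral>t. (cmod (u t))\<^sup>2 \<partial>\<rho>))"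
      using integrable_snd[OF int] by simp
    show "AE \<omega> in P. norm ((cmod (proj u \<omega>))\<^sup>2)
        \<le> norm ((\<integral>t. (cmod (G t \<omega>))\<^sup>2 \<partial>\<rho>) * (\<integral>t. (cmod (u t))\<^sup>2 \<partial>\<rho>))"
      using AE_field_l2
    proof eventually_elim
      fix \<omega> assume "(\<lambda>t. G t \<omega>) \<in> l2 \<rho>"
      from l2_Cauchy_Schwarz[OF this u]
      have "cmod (proj u \<omega>)
          \<le> sqrt ((\<integral>t. (cmod (G t \<omega>))\<^sup>2 \<partial>\<rho>) * (\<integral>t. (cmod (u t))\<^sup>2 \<partial>\<rho>))"
        by (simp add: proj_def l2_inner_self real_sqrt_mult)
      then have "(cmod (proj u \<omega>))\<^sup>2
          \<le> (sqrt ((\<integral>t. (cmod (G t \<omega>))\<^sup>2 \<partial>\<rho>) * (\<integral>t. (cmod (u t))\<^sup>2 \<partial>\<rho>)))\<^sup>2"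
        by (intro power_mono) auto
      then show "norm ((cmod (proj u \<omega>))\<^sup>2)
          \<le> norm ((\<integral>t. (cmod (G t \<omega>))\<^sup>2 \<partial>\<rho>) * (\<integral>t. (cmod (u t))\<^sup>2 \<partial>\<rho>))"
        by simp
    qed
  qed measurable
  then show ?thesis by (simp add: l2_def)
qed

lemma integrable_field_mult:
  assumes u: "u \<in> l2 \<rho>" and Y: "Y \<in> l2 P"
  shows "integrable (\<rho> \<Otimes>\<^sub>M P) (\<lambda>(t, \<omega>). G t \<omega> * cnj (u t) * cnj (Y \<omega>))"
  using integrable_mult_cnj_l2[OF field_l2_pair mult_l2_pair[OF u Y]]
  by (simp add: split_def mult.assoc)

lemma inner_proj_left:
  assumes u: "u \<in> l2 \<rho>" and Y: "Y \<in> l2 P"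
  shows "l2_inner P (proj u) Y = (\<integral>s. l2_inner P (G s) Y * cnj (u s) \<partial>\<rho>)"
proof -
  have "l2_inner P (proj u) Y = (\<integral>\<omega>. (\<integral>t. G t \<omega> * cnj (u t) * cnj (Y \<omega>) \<partial>\<rho>) \<partial>P)"
    by (simp add: l2_inner_def proj_def)
  also have "\<dots> = (\<integral>t. (\<integral>\<omega>. G t \<omega> * cnj (u t) * cnj (Y \<omega>) \<partial>P) \<partial>\<rho>)"
    by (rule Fubini_integral[OF integrable_field_mult[OF u Y]])
  also have "\<dots> = (\<integral>t. (\<integral>\<omega>. G t \<omega> * cnj (Y \<omega>) * cnj (u t) \<partial>P) \<partial>\<rho>)"
    by (simp add: mult_ac)
  finally show ?thesis by (simp add: l2_inner_def)
qed

text \<open>This factors the integral operator through L2(P): \<open>proj\<close> followed by taking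
  inner products with G(s). Every use of the eigenvalue equation passes through this
  identity.\<close>

lemma inner_proj_right:
  assumes u: "u \<in> l2 \<rho>"
  shows "l2_inner P (G s) (proj u) = integral_op \<rho> K u s"
proof -
  have "l2_inner P (G s) (proj u) = cnj (\<integral>t. l2_inner P (G t) (G s) * cnj (u t) \<partial>\<rho>)"
    by (subst l2_inner_commute) (simp add: inner_proj_left[OF u field_l2])
  also have "\<dots> = (\<integral>t. cnj (l2_inner P (G t) (G s) * cnj (u t)) \<partial>\<rho>)"
    by (rule Bochner_Integration.integral_cnj[symmetric])
  also have "\<dots> = (\<integral>t. l2_inner P (G s) (G t) * u t \<partial>\<rho>)"
    by (simp add: l2_inner_commute[of P "G s"])
  finally show ?thesis by (simp add: integral_op_def cov_kernel_eq_inner)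
qed

lemma measurable_integral_op [measurable]:
  assumes [measurable]: "u \<in> borel_measurable \<rho>"
  shows "integral_op \<rho> K u \<in> borel_measurable \<rho>"
  unfolding integral_op_def by measurable

lemma integrable_sqrt_variance_mult:
  assumes u: "u \<in> l2 \<rho>"
  shows "integrable \<rho> (\<lambda>t. sqrt (Re (K t t)) * cmod (u t))"
proof -
  have "(\<lambda>t. complex_of_real (sqrt (Re (K t t)))) \<in> l2 \<rho>"
    using integrable_variance by (simp add: l2_def variance_nonneg)
  from integrable_norm_mult_l2[OF this u] show ?thesis by (simp add: variance_nonneg)
qed

lemma integrable_variance_dominant:
  assumes u: "u \<in> l2 \<rho>"
  shows "integrable (\<rho> \<Otimes>\<^sub>M \<rho>)
    (\<lambda>(s, t). sqrt (Re (K s s)) * cmod (u s) * (sqrt (Re (K t t)) * cmod (u t)))"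
  by (rule index_pair.integrable_pair_mult) (rule integrable_sqrt_variance_mult[OF u])+

text \<open>The quadratic form <T_K u, u>, written over pairs because that is where the Mercer
  expansion is given. Cauchy-Schwarz for K supplies a product-form majorant.\<close>

lemma inner_proj_self:
  assumes u: "u \<in> l2 \<rho>"
  shows "integrable (\<rho> \<Otimes>\<^sub>M \<rho>) (\<lambda>(s, t). K s t * (cnj (u s) * u t))"
    and "l2_inner P (proj u) (proj u) = (\<integral>(s, t). K s t * (cnj (u s) * u t) \<partial>(\<rho> \<Otimes>\<^sub>M \<rho>))"
proof -
  note [measurable] = l2D(1)[OF u]
  show int: "integrable (\<rho> \<Otimes>\<^sub>M \<rho>) (\<lambda>(s, t). K s t * (cnj (u s) * u t))"
  proof (rule Bochner_Integration.integrable_bound[OF integrable_variance_dominant[OF u]])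
    show "AE z in \<rho> \<Otimes>\<^sub>M \<rho>. norm (case z of (s, t) \<Rightarrow> K s t * (cnj (u s) * u t))
      \<le> norm (case z of (s, t) \<Rightarrow> sqrt (Re (K s s)) * cmod (u s) * (sqrt (Re (K t t)) * cmod (u t)))"
    proof (rule AE_I2, clarify)
      fix s t
      have "cmod (K s t) * (cmod (u s) * cmod (u t))
          \<le> (sqrt (Re (K s s)) * sqrt (Re (K t t))) * (cmod (u s) * cmod (u t))"
        by (intro mult_right_mono norm_cov_kernel_le) simp
      then show "norm (K s t * (cnj (u s) * u t))
          \<le> norm (sqrt (Re (K s s)) * cmod (u s) * (sqrt (Re (K t t)) * cmod (u t)))"
        by (simp add: norm_mult variance_nonneg mult_ac)
    qed
  qed measurable
  have "l2_inner P (proj u) (proj u) = (\<integral>s. integral_op \<rho> K u s * cnj (u s) \<partial>\<rho>)"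
    by (simp add: inner_proj_left[OF u proj_l2[OF u]] inner_proj_right[OF u])
  also have "\<dots> = (\<integral>s. (\<integral>t. K s t * (cnj (u s) * u t) \<partial>\<rho>) \<partial>\<rho>)"
    unfolding integral_op_def
    by (subst integral_mult_left_zero[symmetric]) (simp add: mult_ac)
  also have "\<dots> = (\<integral>(s, t). K s t * (cnj (u s) * u t) \<partial>(\<rho> \<Otimes>\<^sub>M \<rho>))"
    by (rule index_pair.integral_fst[OF int])
  finally show "l2_inner P (proj u) (proj u) = (\<integral>(s, t). K s t * (cnj (u s) * u t) \<partial>(\<rho> \<Otimes>\<^sub>M \<rho>))" .
qed

end

section \<open>The Mercer expansion on the diagonal\<close>

text \<open>Fatou's lemma with a uniform bound in place of the lower limit. It serves three times:
  for the L1 limit of the residuals, for the trace, and for the diagonal.\<close>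

lemma nn_integral_le_of_tendsto:
  fixes f :: "nat \<Rightarrow> 'a \<Rightarrow> real"
  assumes [measurable]: "\<And>n. f n \<in> borel_measurable M"
    and lim: "AE x in M. (\<lambda>n. f n x) \<longlonglongrightarrow> g x"
    and bound: "\<And>n. (\<integral>\<^sup>+x. ennreal (f n x) \<partial>M) \<le> C"
  shows "(\<integral>\<^sup>+x. ennreal (g x) \<partial>M) \<le> C"
proof -
  have "(\<integral>\<^sup>+x. ennreal (g x) \<partial>M) = (\<integral>\<^sup>+x. liminf (\<lambda>n. ennreal (f n x)) \<partial>M)"
    using lim
    by (intro nn_integral_cong_AE, eventually_elim)
      (simp add: lim_imp_Liminf[OF _ tendsto_ennrealI])
  also have "\<dots> \<le> liminf (\<lambda>n. \<integral>\<^sup>+x. ennreal (f n x) \<partial>M)"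
    by (rule nn_integral_liminf) measurable
  also have "\<dots> \<le> limsup (\<lambda>n. \<integral>\<^sup>+x. ennreal (f n x) \<partial>M)"
    by (rule Liminf_le_Limsup) simp
  also have "\<dots> \<le> C"
    by (rule Limsup_bounded) (simp add: bound)
  finally show ?thesis .
qed

lemma indicator_mult_l2:
  assumes A: "A \<in> sets M" and u: "u \<in> l2 M"
  shows "(\<lambda>t. indicator A t * u t) \<in> l2 M"
proof -
  note [measurable] = A l2D(1)[OF u]
  have "integrable M (\<lambda>t. indicator A t *\<^sub>R (cmod (u t))\<^sup>2)"
    by (rule integrable_mult_indicator[OF A l2D(2)[OF u]])
  moreover have "(cmod (indicator A t * u t))\<^sup>2 = indicator A t *\<^sub>R (cmod (u t))\<^sup>2" for t
    by (auto simp: indicator_def)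
  ultimately show ?thesis by (simp add: l2_def)
qed

lemma (in finite_measure) indicator_l2:
  assumes "A \<in> sets M"
  shows "indicator A \<in> l2 M"
  using indicator_mult_l2[OF assms, of "\<lambda>_. 1"] by (simp add: l2_def)

context pair_sigma_finite
begin

lemma AE_pair_fst:
  assumes "AE x in M1. Q x"
  shows "AE z in M1 \<Otimes>\<^sub>M M2. Q (fst z)"
proof -
  from assms obtain A where A: "{x \<in> space M1. \<not> Q x} \<subseteq> A" "emeasure M1 A = 0" "A \<in> sets M1"
    by (rule AE_E)
  show ?thesis
    by (rule AE_I[where N = "A \<times> space M2"])
      (use A in \<open>auto simp: space_pair_measure M2.emeasure_pair_measure_Times\<close>)
qed

lemma AE_pair_snd:
  assumes "AE x in M2. Q x"
  shows "AE z in M1 \<Otimes>\<^sub>M M2. Q (snd z)"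
proof -
  from assms obtain A where A: "{x \<in> space M2. \<not> Q x} \<subseteq> A" "emeasure M2 A = 0" "A \<in> sets M2"
    by (rule AE_E)
  show ?thesis
    by (rule AE_I[where N = "space M1 \<times> A"])
      (use A in \<open>auto simp: space_pair_measure M2.emeasure_pair_measure_Times\<close>)
qed

lemma integral_pair_mult:
  fixes f :: "'a \<Rightarrow> 'c::{real_normed_field, banach, second_countable_topology}"
  assumes f: "integrable M1 f" and g: "integrable M2 g"
  shows "(\<integral>(x, y). f x * g y \<partial>(M1 \<Otimes>\<^sub>M M2)) = (\<integral>x. f x \<partial>M1) * (\<integral>y. g y \<partial>M2)"
  by (subst integral_fst[symmetric, OF integrable_pair_mult[OF f g]]) simp

end

locale mercer_field = l2_field \<rho> P G
  for \<rho> :: "'a measure" and P :: "'w measure" and G +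
  fixes I :: "nat set" and \<alpha> :: "nat \<Rightarrow> real" and e :: "nat \<Rightarrow> 'a \<Rightarrow> complex"
  assumes eigenvalue_pos: "i \<in> I \<Longrightarrow> 0 < \<alpha> i"
    and orthonormal: "orthonormal_system \<rho> I e"
    and eigenfunction: "i \<in> I \<Longrightarrow>
      AE s in \<rho>. integral_op \<rho> K (e i) s = complex_of_real (\<alpha> i) * e i s"
    and mercer: "AE (s, t) in \<rho> \<Otimes>\<^sub>M \<rho>.
      ((\<lambda>i. complex_of_real (\<alpha> i) * e i s * cnj (e i t)) has_sum K s t) I"
begin

section \<open>Truncated kernels, the residual field and its covariance\<close>

lemma e_l2: "i \<in> I \<Longrightarrow> e i \<in> l2 \<rho>"
  and inner_e: "i \<in> I \<Longrightarrow> j \<in> I \<Longrightarrow> l2_inner \<rho> (e i) (e j) = (if i = j then 1 else 0)"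
  using orthonormal by (auto simp: orthonormal_system_def)

text \<open>Cutting by the index itself keeps \<open>J N\<close> finite for finite and infinite I
  alike, and makes sums over it partial sums of a series over all naturals.\<close>

definition J :: "nat \<Rightarrow> nat set" where
  "J N = I \<inter> {..<N}"

definition KN :: "nat \<Rightarrow> 'a \<Rightarrow> 'a \<Rightarrow> complex" where
  "KN N s t = (\<Sum>i\<in>J N. complex_of_real (\<alpha> i) * e i s * cnj (e i t))"

abbreviation coef :: "nat \<Rightarrow> 'w \<Rightarrow> complex" where
  "coef i \<equiv> proj (e i)"

definition R :: "nat \<Rightarrow> 'a \<Rightarrow> 'w \<Rightarrow> complex" where
  "R N t \<omega> = G t \<omega> - (\<Sum>i\<in>J N. e i t * coef i \<omega>)"

text \<open>Each eigenvalue equation holds only almost everywhere. As I is countable, almost every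
  single point satisfies all of them, and at such points the covariance of the residual is exact. A
  condition on single points, unlike one on pairs, has something to say about (t, t).\<close>

definition good :: "'a \<Rightarrow> bool" where
  "good s \<longleftrightarrow> (\<forall>i\<in>I. integral_op \<rho> K (e i) s = complex_of_real (\<alpha> i) * e i s)"

lemma finite_J [simp]: "finite (J N)"
  and J_subset: "i \<in> J N \<Longrightarrow> i \<in> I"
  and J_mono: "N \<le> M \<Longrightarrow> J N \<subseteq> J M"
  by (auto simp: J_def)

lemma AE_good: "AE s in \<rho>. good s"
  unfolding good_def using eigenfunction by (subst AE_ball_countable) (auto intro: countableI_type)

lemma AE_good_pair: "AE (s, t) in \<rho> \<Otimes>\<^sub>M \<rho>. good s \<and> good t"
  using index_pair.AE_pair_fst[OF AE_good] index_pair.AE_pair_snd[OF AE_good]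
  by eventually_elim auto

lemma coef_l2: "i \<in> I \<Longrightarrow> coef i \<in> l2 P"
  by (intro proj_l2 e_l2)

text \<open>The left side is <T_K e_i, u>, and e_i is an eigenfunction. For u = e_j this gives the
  orthogonality of the coefficients.\<close>

lemma inner_proj_coef:
  assumes i: "i \<in> I" and u: "u \<in> l2 \<rho>"
  shows "l2_inner P (proj u) (coef i) = complex_of_real (\<alpha> i) * l2_inner \<rho> (e i) u"
proof -
  note [measurable] = l2D(1)[OF u] l2D(1)[OF e_l2[OF i]]
  have "l2_inner P (proj u) (coef i) = (\<integral>s. integral_op \<rho> K (e i) s * cnj (u s) \<partial>\<rho>)"
    by (simp add: inner_proj_left[OF u coef_l2[OF i]] inner_proj_right[OF e_l2[OF i]])
  also have "\<dots> = (\<integral>s. complex_of_real (\<alpha> i) * (e i s * cnj (u s)) \<partial>\<rho>)"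
    using eigenfunction[OF i] by (intro integral_cong_AE) auto
  finally show ?thesis by (simp add: l2_inner_def)
qed

lemma inner_coef:
  assumes "i \<in> I" "j \<in> I"
  shows "l2_inner P (coef i) (coef j) = (if i = j then complex_of_real (\<alpha> i) else 0)"
  using assms by (simp add: inner_proj_coef e_l2 inner_e)

lemma inner_field_coef:
  assumes "good s" "i \<in> I"
  shows "l2_inner P (G s) (coef i) = complex_of_real (\<alpha> i) * e i s"
  using assms by (simp add: inner_proj_right e_l2 good_def)

lemma R_l2: "R N t \<in> l2 P"
  unfolding R_def by (intro l2_diff l2_sum l2_cmult field_l2 coef_l2 J_subset)

lemma inner_R:
  assumes "good s" "good t"
  shows "l2_inner P (R N s) (R N t) = K s t - KN N s t"
  unfolding R_def KN_def cov_kernel_eq_inner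
  by (rule l2_inner_residual)
    (use assms in \<open>auto simp: J_def field_l2 coef_l2 inner_coef inner_field_coef\<close>)

lemma KN_diag: "KN N t t = complex_of_real (\<Sum>i\<in>J N. \<alpha> i * (cmod (e i t))\<^sup>2)"
  by (simp add: KN_def complex_norm_square mult.assoc del: of_real_power)

lemma Re_KN_diag: "Re (KN N t t) = (\<Sum>i\<in>J N. \<alpha> i * (cmod (e i t))\<^sup>2)"
  by (simp add: KN_diag)

lemma Re_KN_diag_mono: "N \<le> M \<Longrightarrow> Re (KN N t t) \<le> Re (KN M t t)"
  unfolding Re_KN_diag
  by (rule sum_mono2) (auto dest: J_mono J_subset intro!: less_imp_le[OF eigenvalue_pos] mult_nonneg_nonneg)

lemma Re_KN_diag_nonneg: "0 \<le> Re (KN N t t)"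
  using Re_KN_diag_mono[of 0 N t] by (simp add: Re_KN_diag J_def)

lemma Re_KN_diag_le: "good t \<Longrightarrow> Re (KN N t t) \<le> Re (K t t)"
  using Re_l2_inner_self_nonneg[of P "R N t"] by (simp add: inner_R)

lemma norm_residual_kernel_le:
  assumes "good s" "good t"
  shows "cmod (K s t - KN N s t) \<le> sqrt (Re (K s s) - Re (KN N s s)) * sqrt (Re (K t t) - Re (KN N t t))"
  using l2_Cauchy_Schwarz[OF R_l2 R_l2, of N s N t] assms by (simp add: inner_R)

text \<open>A bound free of N, as dominated convergence requires.\<close>

lemma norm_residual_kernel_le':
  assumes "good s" "good t"
  shows "cmod (K s t - KN N s t) \<le> sqrt (Re (K s s)) * sqrt (Re (K t t))"
  by (rule order_trans[OF norm_residual_kernel_le[OF assms]])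
    (intro mult_mono real_sqrt_le_mono, auto simp: Re_KN_diag_nonneg Re_KN_diag_le assms variance_nonneg)

lemma measurable_e: "i \<in> I \<Longrightarrow> e i \<in> borel_measurable \<rho>"
  using e_l2 l2D(1) by blast

lemma measurable_KN [measurable (raw)]:
  assumes "f \<in> measurable M \<rho>" "g \<in> measurable M \<rho>"
  shows "(\<lambda>x. KN N (f x) (g x)) \<in> borel_measurable M"
proof -
  have "(\<lambda>x. e i (f x)) \<in> borel_measurable M" "(\<lambda>x. e i (g x)) \<in> borel_measurable M"
    if "i \<in> J N" for i
    using assms measurable_compose measurable_e[OF J_subset[OF that]] by blast+
  then show ?thesis unfolding KN_def by measurable
qed

section \<open>The residual tested against a fixed function\<close>

lemma mercer_tendsto: "AE (s, t) in \<rho> \<Otimes>\<^sub>M \<rho>. (\<lambda>N. KN N s t) \<longlonglongrightarrow> K s t"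
  using mercer
proof eventually_elim
  fix z
  assume "case z of (s, t) \<Rightarrow>
    ((\<lambda>i. complex_of_real (\<alpha> i) * e i s * cnj (e i t)) has_sum K s t) I"
  then obtain s t where z: "z = (s, t)"
    and sum: "((\<lambda>i. complex_of_real (\<alpha> i) * e i s * cnj (e i t)) has_sum K s t) I"
    by (cases z) auto
  let ?f = "\<lambda>i. complex_of_real (\<alpha> i) * e i s * cnj (e i t)"
  \<comment> \<open>Extension by 0 outside I turns the unordered sum over I into a series whose
    partial sums are \<open>KN\<close>.\<close>
  have "((\<lambda>i. if i \<in> I then ?f i else 0) has_sum K s t) UNIV"
    by (rule has_sum_cong_neutral[THEN iffD1, OF _ _ _ sum]) auto
  then have "(\<lambda>i. if i \<in> I then ?f i else 0) sums K s t"
    by (rule has_sum_imp_sums)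
  then have "(\<lambda>N. \<Sum>i<N. if i \<in> I then ?f i else 0) \<longlonglongrightarrow> K s t"
    by (simp add: sums_def)
  moreover have "(\<Sum>i<N. if i \<in> I then ?f i else 0) = KN N s t" for N
    unfolding KN_def J_def by (subst sum.inter_restrict[symmetric]) (auto intro: sum.cong)
  ultimately show "case z of (s, t) \<Rightarrow> (\<lambda>N. KN N s t) \<longlonglongrightarrow> K s t"
    using z by simp
qed

text \<open>For almost every \<omega> this is the inner product of the path of \<open>R N\<close>
  with u. Written with \<open>proj\<close> it has the shape that \<open>l2_inner_residual\<close>
  expects.\<close>

definition Z :: "nat \<Rightarrow> ('a \<Rightarrow> complex) \<Rightarrow> 'w \<Rightarrow> complex" where
  "Z N u \<omega> = proj u \<omega> - (\<Sum>i\<in>J N. l2_inner \<rho> (e i) u * coef i \<omega>)"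

lemma Z_l2: "u \<in> l2 \<rho> \<Longrightarrow> Z N u \<in> l2 P"
  unfolding Z_def by (intro l2_diff l2_sum l2_cmult proj_l2 coef_l2 J_subset)

lemma inner_Z:
  assumes u: "u \<in> l2 \<rho>"
  shows "l2_inner P (Z N u) (Z N u) = (\<integral>(s, t). (K s t - KN N s t) * (cnj (u s) * u t) \<partial>(\<rho> \<Otimes>\<^sub>M \<rho>))"
proof -
  let ?a = "\<lambda>i. l2_inner \<rho> (e i) u"
  \<comment> \<open>Factors are grouped by variable, so that the integral over pairs splits into <e
    i, u> times <u, e i>.\<close>
  let ?h = "\<lambda>i (s, t). complex_of_real (\<alpha> i) * ((e i s * cnj (u s)) * (u t * cnj (e i t)))"
  have int: "integrable (\<rho> \<Otimes>\<^sub>M \<rho>) (?h i)"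
    and val: "(\<integral>z. ?h i z \<partial>(\<rho> \<Otimes>\<^sub>M \<rho>)) = complex_of_real (\<alpha> i) * ?a i * cnj (?a i)"
    if "i \<in> J N" for i
  proof -
    have i: "e i \<in> l2 \<rho>" using that by (intro e_l2 J_subset)
    note f = integrable_mult_cnj_l2[OF i u] and g = integrable_mult_cnj_l2[OF u i]
    show "integrable (\<rho> \<Otimes>\<^sub>M \<rho>) (?h i)"
      using integrable_mult_right[OF index_pair.integrable_pair_mult[OF f g]] by (simp add: split_def)
    have "(\<integral>z. ?h i z \<partial>(\<rho> \<Otimes>\<^sub>M \<rho>))
      = complex_of_real (\<alpha> i) * (\<integral>(s, t). (e i s * cnj (u s)) * (u t * cnj (e i t)) \<partial>(\<rho> \<Otimes>\<^sub>M \<rho>))"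
      by (subst integral_mult_right_zero[symmetric]) (simp add: split_def)
    also have "\<dots> = complex_of_real (\<alpha> i) * (?a i * l2_inner \<rho> u (e i))"
      using index_pair.integral_pair_mult[OF f g] by (simp add: l2_inner_def)
    finally show "(\<integral>z. ?h i z \<partial>(\<rho> \<Otimes>\<^sub>M \<rho>)) = complex_of_real (\<alpha> i) * ?a i * cnj (?a i)"
      by (simp add: l2_inner_commute[of \<rho> u "e i"])
  qed
  have "l2_inner P (Z N u) (Z N u)
    = l2_inner P (proj u) (proj u) - (\<Sum>i\<in>J N. complex_of_real (\<alpha> i) * ?a i * cnj (?a i))"
    unfolding Z_def
    by (rule l2_inner_residual)
      (use u in \<open>auto simp: J_def proj_l2 coef_l2 inner_coef inner_proj_coef\<close>)
  also have "(\<Sum>i\<in>J N. complex_of_real (\<alpha> i) * ?a i * cnj (?a i))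
    = (\<integral>z. (\<Sum>i\<in>J N. ?h i z) \<partial>(\<rho> \<Otimes>\<^sub>M \<rho>))"
    by (subst Bochner_Integration.integral_sum) (simp_all add: int val)
  also have "l2_inner P (proj u) (proj u) - \<dots>
    = (\<integral>z. (case z of (s, t) \<Rightarrow> K s t * (cnj (u s) * u t)) - (\<Sum>i\<in>J N. ?h i z) \<partial>(\<rho> \<Otimes>\<^sub>M \<rho>))"
    unfolding inner_proj_self(2)[OF u]
    by (rule Bochner_Integration.integral_diff[symmetric]) (auto intro!: inner_proj_self(1)[OF u] int)
  also have "\<dots> = (\<integral>(s, t). (K s t - KN N s t) * (cnj (u s) * u t) \<partial>(\<rho> \<Otimes>\<^sub>M \<rho>))"
  proof -
    have "(\<Sum>i\<in>J N. ?h i (s, t)) = KN N s t * (cnj (u s) * u t)" for s t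
      unfolding KN_def sum_distrib_right by (simp add: mult_ac)
    then show ?thesis by (simp add: split_def left_diff_distrib)
  qed
  finally show ?thesis .
qed

text \<open>Here the assumed convergence of the Mercer series enters: \<open>inner_Z\<close> is an
  integral over pairs, so an exceptional null set of pairs does no harm.\<close>

lemma Z_tendsto_zero:
  assumes u: "u \<in> l2 \<rho>"
  shows "(\<lambda>N. Re (l2_inner P (Z N u) (Z N u))) \<longlonglongrightarrow> 0"
proof -
  note [measurable] = l2D(1)[OF u]
  let ?f = "\<lambda>N (s, t). (K s t - KN N s t) * (cnj (u s) * u t)"
  have "(\<lambda>N. integral\<^sup>L (\<rho> \<Otimes>\<^sub>M \<rho>) (?f N)) \<longlonglongrightarrow> integral\<^sup>L (\<rho> \<Otimes>\<^sub>M \<rho>) (\<lambda>_. 0)"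
  proof (rule integral_dominated_convergence[OF _ _ integrable_variance_dominant[OF u]])
    show "AE z in \<rho> \<Otimes>\<^sub>M \<rho>. (\<lambda>N. ?f N z) \<longlonglongrightarrow> 0"
      using mercer_tendsto
    proof eventually_elim
      fix z assume z: "case z of (s, t) \<Rightarrow> (\<lambda>N. KN N s t) \<longlonglongrightarrow> K s t"
      obtain s t where "z = (s, t)" by (cases z)
      with z show "(\<lambda>N. ?f N z) \<longlonglongrightarrow> 0"
        by (auto intro!: tendsto_mult_left_zero simp: LIM_zero_iff tendsto_minus_cancel_left[symmetric]
          intro: tendsto_eq_intros)
    qed
    show "AE z in \<rho> \<Otimes>\<^sub>M \<rho>. norm (?f N z)
      \<le> (case z of (s, t) \<Rightarrow> sqrt (Re (K s s)) * cmod (u s) * (sqrt (Re (K t t)) * cmod (u t)))" for N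
      using AE_good_pair
    proof eventually_elim
      fix z assume z: "case z of (s, t) \<Rightarrow> good s \<and> good t"
      obtain s t where st: "z = (s, t)" by (cases z)
      have "cmod (K s t - KN N s t) * (cmod (u s) * cmod (u t))
        \<le> (sqrt (Re (K s s)) * sqrt (Re (K t t))) * (cmod (u s) * cmod (u t))"
        using z st by (intro mult_right_mono norm_residual_kernel_le') auto
      then show "norm (?f N z)
        \<le> (case z of (s, t) \<Rightarrow> sqrt (Re (K s s)) * cmod (u s) * (sqrt (Re (K t t)) * cmod (u t)))"
        by (simp add: st norm_mult mult_ac)
    qed
  qed measurable
  then have "(\<lambda>N. l2_inner P (Z N u) (Z N u)) \<longlonglongrightarrow> 0"
    by (simp add: inner_Z[OF u])
  then show ?thesis using tendsto_Re by fastforce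
qed

section \<open>The trace formula\<close>

lemma integrable_Re_KN_diag: "integrable \<rho> (\<lambda>t. Re (KN N t t))"
  and integral_Re_KN_diag: "(\<integral>t. Re (KN N t t) \<partial>\<rho>) = (\<Sum>i\<in>J N. \<alpha> i)"
proof -
  have one: "(\<integral>t. (cmod (e i t))\<^sup>2 \<partial>\<rho>) = 1" if "i \<in> J N" for i
    using inner_e[of i i] J_subset[OF that] by (simp add: l2_inner_self)
  have int: "integrable \<rho> (\<lambda>t. \<alpha> i * (cmod (e i t))\<^sup>2)" if "i \<in> J N" for i
    using l2D(2)[OF e_l2[OF J_subset[OF that]]] by simp
  show "integrable \<rho> (\<lambda>t. Re (KN N t t))"
    unfolding Re_KN_diag by (rule Bochner_Integration.integrable_sum) (rule int)
  show "(\<integral>t. Re (KN N t t) \<partial>\<rho>) = (\<Sum>i\<in>J N. \<alpha> i)"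
    unfolding Re_KN_diag by (subst Bochner_Integration.integral_sum[OF int]) (simp_all add: one)
qed

definition trace :: real where
  "trace = (\<integral>t. Re (K t t) \<partial>\<rho>)"

text \<open>The easy half of the trace formula, from K_N(t, t) <= K(t, t) at good points. It has to
  come first: it makes the partial sums converge, and thereby the residuals Cauchy.\<close>

lemma sum_J_le_trace: "(\<Sum>i\<in>J N. \<alpha> i) \<le> trace"
  unfolding trace_def integral_Re_KN_diag[symmetric]
  using AE_good integrable_Re_KN_diag integrable_variance
  by (intro integral_mono_AE) (auto simp: Re_KN_diag_le elim: eventually_mono)

lemma sum_J_mono: "N \<le> M \<Longrightarrow> (\<Sum>i\<in>J N. \<alpha> i) \<le> (\<Sum>i\<in>J M. \<alpha> i)"
  using J_mono by (intro sum_mono2) (auto intro!: less_imp_le[OF eigenvalue_pos] dest: J_subset)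

lemma sum_J_convergent: "convergent (\<lambda>N. \<Sum>i\<in>J N. \<alpha> i)"
  using incseq_convergent[of "\<lambda>N. \<Sum>i\<in>J N. \<alpha> i" trace] sum_J_le_trace sum_J_mono
  by (metis convergentI incseq_def)

text \<open>F is an arbitrary index set so that the difference of two residuals, a sum over
  \<open>J M - J N\<close>, is covered as well as a partial sum of the expansion.\<close>

definition V :: "nat set \<Rightarrow> 'a \<times> 'w \<Rightarrow> complex" where
  "V F = (\<lambda>(t, \<omega>). \<Sum>i\<in>F. e i t * coef i \<omega>)"

lemma V_l2:
  assumes "F \<subseteq> I"
  shows "V F \<in> l2 (\<rho> \<Otimes>\<^sub>M P)"
proof -
  have "(\<lambda>z. e i (fst z) * coef i (snd z)) \<in> l2 (\<rho> \<Otimes>\<^sub>M P)" if "i \<in> F" for i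
    using mult_l2_pair[OF e_l2 coef_l2, of i i] that assms by (auto simp: split_def)
  then show ?thesis
    unfolding V_def split_def by (rule l2_sum)
qed

text \<open>Orthogonality of the coefficients over P removes the cross terms at every fixed t; the
  integral over t then uses only that each e i has norm 1.\<close>

lemma integral_norm_V:
  assumes "finite F" "F \<subseteq> I"
  shows "(\<integral>z. (cmod (V F z))\<^sup>2 \<partial>(\<rho> \<Otimes>\<^sub>M P)) = (\<Sum>i\<in>F. \<alpha> i)"
proof -
  have one: "(\<integral>t. (cmod (e i t))\<^sup>2 \<partial>\<rho>) = 1" if "i \<in> F" for i
    using inner_e[of i i] that assms by (auto simp: l2_inner_self)
  have int: "integrable \<rho> (\<lambda>t. \<alpha> i * (cmod (e i t))\<^sup>2)" if "i \<in> F" for i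
    using l2D(2)[OF e_l2, of i] that assms by auto
  have "(\<integral>z. (cmod (V F z))\<^sup>2 \<partial>(\<rho> \<Otimes>\<^sub>M P)) = (\<integral>t. (\<integral>\<omega>. (cmod (V F (t, \<omega>)))\<^sup>2 \<partial>P) \<partial>\<rho>)"
    using l2D(2)[OF V_l2] assms by (intro integral_fst'[symmetric]) auto
  also have "\<dots> = (\<integral>t. Re (l2_inner P (\<lambda>\<omega>. \<Sum>i\<in>F. e i t * coef i \<omega>) (\<lambda>\<omega>. \<Sum>i\<in>F. e i t * coef i \<omega>)) \<partial>\<rho>)"
    by (simp add: V_def l2_inner_self)
  also have "\<dots> = (\<integral>t. (\<Sum>i\<in>F. \<alpha> i * (cmod (e i t))\<^sup>2) \<partial>\<rho>)"
  proof (intro Bochner_Integration.integral_cong refl)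
    fix t
    have "l2_inner P (\<lambda>\<omega>. \<Sum>i\<in>F. e i t * coef i \<omega>) (\<lambda>\<omega>. \<Sum>i\<in>F. e i t * coef i \<omega>)
      = (\<Sum>i\<in>F. complex_of_real (\<alpha> i * (cmod (e i t))\<^sup>2))"
      using assms by (intro l2_inner_orthogonal_sum) (auto simp: coef_l2 inner_coef subset_iff)
    then show "Re (l2_inner P (\<lambda>\<omega>. \<Sum>i\<in>F. e i t * coef i \<omega>) (\<lambda>\<omega>. \<Sum>i\<in>F. e i t * coef i \<omega>))
      = (\<Sum>i\<in>F. \<alpha> i * (cmod (e i t))\<^sup>2)"
      by (simp del: of_real_mult of_real_power)
  qed
  also have "\<dots> = (\<Sum>i\<in>F. \<alpha> i)"
    by (subst Bochner_Integration.integral_sum[OF int]) (simp_all add: one)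
  finally show ?thesis .
qed

lemma R_eq: "(\<lambda>(t, \<omega>). R N t \<omega>) = (\<lambda>z. (\<lambda>(t, \<omega>). G t \<omega>) z - V (J N) z)"
  by (auto simp: R_def V_def)

lemma R_l2_pair: "(\<lambda>(t, \<omega>). R N t \<omega>) \<in> l2 (\<rho> \<Otimes>\<^sub>M P)"
  unfolding R_eq by (intro l2_diff field_l2_pair V_l2) (auto dest: J_subset)

lemma R_diff:
  assumes "N \<le> M"
  shows "R N t \<omega> - R M t \<omega> = V (J M - J N) (t, \<omega>)"
  using sum.subset_diff[OF J_mono[OF assms] finite_J, of "\<lambda>i. e i t * coef i \<omega>"]
  by (simp add: R_def V_def)

text \<open>The restriction to A is absorbed into the test function and the restriction to B becomes
  an inner product with an indicator, so that \<open>Z_tendsto_zero\<close> controls integrals over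
  rectangles.\<close>

lemma integral_R_indicator:
  assumes w: "w \<in> l2 \<rho>" and A: "A \<in> sets \<rho>" and B: "B \<in> sets P"
  shows "(LINT z:A \<times> B|\<rho> \<Otimes>\<^sub>M P. R N (fst z) (snd z) * cnj (w (fst z)))
    = l2_inner P (Z N (\<lambda>t. indicator A t * w t)) (indicator B)"
proof -
  let ?u = "\<lambda>t. indicator A t * w t"
  note [measurable] = A B l2D(1)[OF w]
  note u = indicator_mult_l2[OF A w] and one = prob.indicator_l2[OF B]
  have int: "integrable (\<rho> \<Otimes>\<^sub>M P) (\<lambda>(t, \<omega>). R N t \<omega> * cnj (?u t * indicator B \<omega>))"
    using integrable_mult_cnj_l2[OF R_l2_pair mult_l2_pair[OF u one]] by (simp add: split_def)
  have "(LINT z:A \<times> B|\<rho> \<Otimes>\<^sub>M P. R N (fst z) (snd z) * cnj (w (fst z)))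
    = (\<integral>(t, \<omega>). R N t \<omega> * cnj (?u t * indicator B \<omega>) \<partial>(\<rho> \<Otimes>\<^sub>M P))"
    unfolding set_lebesgue_integral_def
    by (intro Bochner_Integration.integral_cong) (auto simp: indicator_def)
  also have "\<dots> = (\<integral>\<omega>. (\<integral>t. R N t \<omega> * cnj (?u t * indicator B \<omega>) \<partial>\<rho>) \<partial>P)"
    by (rule integral_snd[symmetric, OF int])
  also have "\<dots> = (\<integral>\<omega>. l2_inner \<rho> (\<lambda>t. R N t \<omega>) ?u * cnj (indicator B \<omega>) \<partial>P)"
    by (simp add: l2_inner_def mult.assoc[symmetric])
  also have "\<dots> = (\<integral>\<omega>. Z N ?u \<omega> * cnj (indicator B \<omega>) \<partial>P)"
  proof (rule integral_cong_AE)
    have [measurable]: "(\<lambda>(t, \<omega>). R N t \<omega>) \<in> borel_measurable (\<rho> \<Otimes>\<^sub>M P)"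
      by (rule l2D(1)[OF R_l2_pair])
    show "(\<lambda>\<omega>. l2_inner \<rho> (\<lambda>t. R N t \<omega>) ?u * cnj (indicator B \<omega>)) \<in> borel_measurable P"
      unfolding l2_inner_def by measurable
    show "(\<lambda>\<omega>. Z N ?u \<omega> * cnj (indicator B \<omega>)) \<in> borel_measurable P"
      using l2D(1)[OF Z_l2[OF u]] by measurable
    show "AE \<omega> in P. l2_inner \<rho> (\<lambda>t. R N t \<omega>) ?u * cnj (indicator B \<omega>)
        = Z N ?u \<omega> * cnj (indicator B \<omega>)"
      using AE_field_l2
    proof eventually_elim
      fix \<omega> assume G: "(\<lambda>t. G t \<omega>) \<in> l2 \<rho>"
      have e: "e i \<in> l2 \<rho>" if "i \<in> J N" for i using that by (intro e_l2 J_subset)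
      then have S: "(\<lambda>t. \<Sum>i\<in>J N. coef i \<omega> * e i t) \<in> l2 \<rho>"
        by (intro l2_sum l2_cmult)
      have "l2_inner \<rho> (\<lambda>t. R N t \<omega>) ?u
        = l2_inner \<rho> (\<lambda>t. G t \<omega>) ?u - l2_inner \<rho> (\<lambda>t. \<Sum>i\<in>J N. coef i \<omega> * e i t) ?u"
        using l2_inner_diff_left[OF G S u] by (simp add: R_def mult.commute[of "coef _ \<omega>"])
      also have "\<dots> = Z N ?u \<omega>"
        using u e by (subst l2_inner_sum_left) (auto simp: Z_def proj_def mult.commute)
      finally show "l2_inner \<rho> (\<lambda>t. R N t \<omega>) ?u * cnj (indicator B \<omega>)
          = Z N ?u \<omega> * cnj (indicator B \<omega>)" by simp
    qed
  qed
  finally show ?thesis by (simp add: l2_inner_def)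
qed

text \<open>The Cauchy sequence has a limit Y after weighting. By Cauchy-Schwarz with
  \<open>Z_tendsto_zero\<close> the integrals of the weighted residuals over rectangles tend to 0,
  so those of Y vanish and Y = 0 almost everywhere.\<close>

lemma ex_residual_subseq:
  "\<exists>r. strict_mono r \<and> (AE z in \<rho> \<Otimes>\<^sub>M P. (\<lambda>n. R (r n) (fst z) (snd z)) \<longlonglongrightarrow> 0)"
proof -
  let ?PP = "\<rho> \<Otimes>\<^sub>M P"
  let ?S = "\<lambda>N. \<Sum>i\<in>J N. \<alpha> i"
  obtain f :: "'a \<Rightarrow> real" where f [measurable]: "f \<in> borel_measurable \<rho>"
    and f_pos: "\<And>t. 0 < f t" and f_int: "integrable \<rho> f"
    using index.obtain_positive_integrable_function by metis
  \<comment> \<open>\<rho> may be infinite, so square integrable functions need not be integrable. A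
    nowhere vanishing weight in L2(\<rho>), the root of a positive integrable function, brings the
    residuals into L1 and can be divided out at the end.\<close>
  define w where "w t = complex_of_real (sqrt (f t))" for t
  have w_pos: "w t \<noteq> 0" for t using f_pos[of t] by (simp add: w_def)
  have w: "w \<in> l2 \<rho>"
    using f_int f_pos by (simp add: l2_def w_def[abs_def] less_imp_le)
  have one: "(\<lambda>_. 1) \<in> l2 P" by (simp add: l2_def)
  define W where "W z = w (fst z)" for z :: "'a \<times> 'w"
  have W: "W \<in> l2 ?PP"
    using mult_l2_pair[OF w one] by (simp add: W_def[abs_def] split_def)
  define C where "C = sqrt (\<integral>z. (cmod (W z))\<^sup>2 \<partial>?PP)"
  have C: "0 \<le> C" by (simp add: C_def)
  define F where "F N z = R N (fst z) (snd z) * cnj (W z)" for N z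
  have F_int: "integrable ?PP (F N)" for N
    using integrable_mult_cnj_l2[OF R_l2_pair W] by (simp add: F_def[abs_def] split_def)
  have [measurable]: "F N \<in> borel_measurable ?PP" for N
    using F_int by (rule borel_measurable_integrable)
  have dist1: "(\<integral>z. norm (F N z - F M z) \<partial>?PP) \<le> sqrt \<bar>?S M - ?S N\<bar> * C" if "N \<le> M" for N M
  proof -
    have sub: "J M - J N \<subseteq> I" by (auto dest: J_subset)
    have "F N z - F M z = V (J M - J N) z * cnj (W z)" for z
      using R_diff[OF that, of "fst z" "snd z"] by (simp add: F_def left_diff_distrib[symmetric])
    then have "(\<integral>z. norm (F N z - F M z) \<partial>?PP) = (\<integral>z. cmod (V (J M - J N) z) * cmod (W z) \<partial>?PP)"
      by (simp add: norm_mult)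
    also have "\<dots> \<le> sqrt (\<Sum>i\<in>J M - J N. \<alpha> i) * C"
      using l2_Cauchy_Schwarz_norm[OF V_l2[OF sub] W] integral_norm_V[OF _ sub] by (simp add: C_def)
    also have "(\<Sum>i\<in>J M - J N. \<alpha> i) = \<bar>?S M - ?S N\<bar>"
      using sum_J_mono[OF that] by (subst sum_diff) (auto simp: J_mono[OF that])
    finally show ?thesis .
  qed
  have dist: "(\<integral>z. norm (F N z - F M z) \<partial>?PP) \<le> sqrt \<bar>?S M - ?S N\<bar> * C" for N M
    using dist1[of N M] dist1[of M N] by (cases "N \<le> M") (auto simp: norm_minus_commute abs_minus_commute)
  have cauchy: "\<exists>N. \<forall>i\<ge>N. \<forall>j\<ge>N. (\<integral>z. norm (F i z - F j z) \<partial>?PP) < \<epsilon>" if "0 < \<epsilon>" for \<epsilon>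
  proof -
    \<comment> \<open>Chosen so that its root times C stays below \<epsilon>; C + 1 instead of C
      because only 0 \<le> C is known.\<close>
    define \<delta> where "\<delta> = (\<epsilon> / (C + 1))\<^sup>2"
    have "0 < \<delta>" using that C by (simp add: \<delta>_def)
    then obtain N where N: "\<And>i j. i \<ge> N \<Longrightarrow> j \<ge> N \<Longrightarrow> \<bar>?S i - ?S j\<bar> < \<delta>"
      using sum_J_convergent[THEN convergent_Cauchy] by (metis CauchyD real_norm_def)
    have "(\<integral>z. norm (F i z - F j z) \<partial>?PP) < \<epsilon>" if "i \<ge> N" "j \<ge> N" for i j
    proof -
      have "sqrt \<bar>?S j - ?S i\<bar> \<le> sqrt \<delta>"
        using N[OF that(2,1)] by (intro real_sqrt_le_mono) simp
      also have "sqrt \<delta> = \<epsilon> / (C + 1)" using \<open>0 < \<epsilon>\<close> C by (simp add: \<delta>_def)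
      finally have "sqrt \<bar>?S j - ?S i\<bar> * C \<le> \<epsilon> / (C + 1) * C"
        using C by (rule mult_right_mono)
      also have "\<dots> < \<epsilon>" using \<open>0 < \<epsilon>\<close> C by (simp add: field_simps)
      finally show ?thesis using dist[of i j] by simp
    qed
    then show ?thesis by blast
  qed
  obtain r where r: "strict_mono r" and AE_cauchy: "AE z in ?PP. Cauchy (\<lambda>n. F (r n) z)"
    using cauchy_L1_AE_cauchy_subseq[OF F_int cauchy] by blast
  \<comment> \<open>\<open>lim\<close> is total, which makes Y measurable everywhere; it is the
    actual limit where the subsequence converges.\<close>
  define Y where "Y z = lim (\<lambda>n. F (r n) z)" for z
  have [measurable]: "Y \<in> borel_measurable ?PP"
    unfolding Y_def[abs_def] by measurable
  have AE_lim: "AE z in ?PP. (\<lambda>n. F (r n) z) \<longlonglongrightarrow> Y z"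
    using AE_cauchy by eventually_elim (simp add: Y_def Cauchy_convergent_iff convergent_LIMSEQ_iff)
  \<comment> \<open>The subsequence gives a pointwise limit, but the Cauchy property upgrades this
    to L1 convergence of the full sequence: Fatou is applied along the subsequence with i held
    fixed.\<close>
  have close: "\<exists>N. \<forall>i\<ge>N. (\<integral>\<^sup>+z. ennreal (norm (F i z - Y z)) \<partial>?PP) \<le> ennreal \<epsilon>" if pos: "0 < \<epsilon>" for \<epsilon>
  proof -
    obtain N where N: "\<And>i j. i \<ge> N \<Longrightarrow> j \<ge> N \<Longrightarrow> (\<integral>z. norm (F i z - F j z) \<partial>?PP) < \<epsilon>"
      using cauchy[OF pos] by blast
    have "(\<integral>\<^sup>+z. ennreal (norm (F i z - Y z)) \<partial>?PP) \<le> ennreal \<epsilon>" if "i \<ge> N" for i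
    proof (rule nn_integral_le_of_tendsto[where f = "\<lambda>n z. norm (F i z - F (r (n + N)) z)"])
      show "AE z in ?PP. (\<lambda>n. norm (F i z - F (r (n + N)) z)) \<longlonglongrightarrow> norm (F i z - Y z)"
        using AE_lim
        by eventually_elim (intro tendsto_norm tendsto_diff tendsto_const LIMSEQ_ignore_initial_segment)
      fix n
      have "r (n + N) \<ge> N" using seq_suble[OF r, of "n + N"] by simp
      have "(\<integral>\<^sup>+z. ennreal (norm (F i z - F (r (n + N)) z)) \<partial>?PP)
        = ennreal (\<integral>z. norm (F i z - F (r (n + N)) z) \<partial>?PP)"
        by (rule nn_integral_eq_integral) (use F_int in auto)
      also have "\<dots> \<le> ennreal \<epsilon>"
        using N[OF that \<open>r (n + N) \<ge> N\<close>] by (intro ennreal_leI) simp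
      finally show "(\<integral>\<^sup>+z. ennreal (norm (F i z - F (r (n + N)) z)) \<partial>?PP) \<le> ennreal \<epsilon>" .
    qed measurable
    then show ?thesis by blast
  qed
  have Y_int: "integrable ?PP Y"
  proof -
    obtain N where N: "(\<integral>\<^sup>+z. ennreal (norm (F N z - Y z)) \<partial>?PP) \<le> ennreal 1"
      using close[of 1] by auto
    have "integrable ?PP (\<lambda>z. F N z - Y z)"
      using N by (intro integrableI_bounded) (auto simp: less_top[symmetric] top_unique)
    from Bochner_Integration.integrable_diff[OF F_int[of N] this] show ?thesis by simp
  qed
  have "AE z in ?PP. Y z = 0"
  proof (rule AE_zero_if_integral_rectangles_zero[OF Y_int])
    fix A B assume A: "A \<in> sets \<rho>" and B: "B \<in> sets P"
    let ?u = "\<lambda>t. indicator A t * w t"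
    note u = indicator_mult_l2[OF A w] and one = prob.indicator_l2[OF B]
    have AB [measurable]: "A \<times> B \<in> sets ?PP" using A B by simp
    have int: "set_integrable ?PP (A \<times> B) (F N)" "set_integrable ?PP (A \<times> B) Y" for N
      using F_int Y_int AB unfolding set_integrable_def by (auto intro: integrable_mult_indicator)
    have "(\<lambda>N. LINT z:A \<times> B|?PP. F N z) \<longlonglongrightarrow> (LINT z:A \<times> B|?PP. Y z)"
    proof (rule LIMSEQ_I)
      fix \<epsilon> :: real assume "0 < \<epsilon>"
      then obtain N where N: "\<And>i. i \<ge> N \<Longrightarrow> (\<integral>\<^sup>+z. ennreal (norm (F i z - Y z)) \<partial>?PP) \<le> ennreal (\<epsilon> / 2)"
        using close[of "\<epsilon> / 2"] by auto
      have "norm ((LINT z:A \<times> B|?PP. F i z) - (LINT z:A \<times> B|?PP. Y z)) < \<epsilon>" if "i \<ge> N" for i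
      proof -
        have "(LINT z:A \<times> B|?PP. F i z) - (LINT z:A \<times> B|?PP. Y z) = (LINT z:A \<times> B|?PP. F i z - Y z)"
          using int by (simp add: set_integral_diff)
        then have "ennreal (norm ((LINT z:A \<times> B|?PP. F i z) - (LINT z:A \<times> B|?PP. Y z)))
          \<le> (\<integral>\<^sup>+z. ennreal (norm (indicator (A \<times> B) z *\<^sub>R (F i z - Y z))) \<partial>?PP)"
          using F_int Y_int AB unfolding set_lebesgue_integral_def
          by (simp only:) (intro integral_norm_bound_ennreal integrable_mult_indicator
            Bochner_Integration.integrable_diff)
        also have "\<dots> \<le> (\<integral>\<^sup>+z. ennreal (norm (F i z - Y z)) \<partial>?PP)"
          by (intro nn_integral_mono) (auto simp: indicator_def)
        also have "\<dots> \<le> ennreal (\<epsilon> / 2)" by (rule N[OF that])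
        finally show ?thesis using \<open>0 < \<epsilon>\<close> by (simp add: ennreal_le_iff)
      qed
      then show "\<exists>N. \<forall>i\<ge>N. norm ((LINT z:A \<times> B|?PP. F i z) - (LINT z:A \<times> B|?PP. Y z)) < \<epsilon>"
        by blast
    qed
    moreover have "(\<lambda>N. LINT z:A \<times> B|?PP. F N z) \<longlonglongrightarrow> 0"
    proof (rule Lim_null_comparison)
      let ?b = "sqrt (Re (l2_inner P (indicator B) (indicator B)))"
      show "\<forall>\<^sub>F N in sequentially. norm (LINT z:A \<times> B|?PP. F N z) \<le> sqrt (Re (l2_inner P (Z N ?u) (Z N ?u))) * ?b"
        using l2_Cauchy_Schwarz[OF Z_l2[OF u] one] integral_R_indicator[OF w A B]
        by (simp add: F_def W_def)
      show "(\<lambda>N. sqrt (Re (l2_inner P (Z N ?u) (Z N ?u))) * ?b) \<longlonglongrightarrow> 0"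
        using tendsto_mult[OF tendsto_real_sqrt[OF Z_tendsto_zero[OF u]] tendsto_const[of ?b]] by simp
    qed
    ultimately show "(LINT z:A \<times> B|?PP. Y z) = 0" by (rule LIMSEQ_unique)
  qed
  with AE_lim have "AE z in ?PP. (\<lambda>n. R (r n) (fst z) (snd z)) \<longlonglongrightarrow> 0"
  proof eventually_elim
    fix z assume "(\<lambda>n. F (r n) z) \<longlonglongrightarrow> Y z" "Y z = 0"
    then have "(\<lambda>n. F (r n) z / cnj (W z)) \<longlonglongrightarrow> 0 / cnj (W z)"
      by (intro tendsto_divide) (auto simp: W_def w_pos)
    then show "(\<lambda>n. R (r n) (fst z) (snd z)) \<longlonglongrightarrow> 0"
      by (simp add: F_def W_def w_pos)
  qed
  with r show ?thesis by blast
qed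

text \<open>The trace is the squared norm of G on the product space. Almost everywhere along a
  subsequence G is the limit of partial sums whose squared norms stay below L, so Fatou gives the
  missing inequality.\<close>

theorem sum_J_tendsto_trace: "(\<lambda>N. \<Sum>i\<in>J N. \<alpha> i) \<longlonglongrightarrow> trace"
proof -
  let ?S = "\<lambda>N. \<Sum>i\<in>J N. \<alpha> i"
  obtain L where L: "?S \<longlonglongrightarrow> L"
    using sum_J_convergent by (auto simp: convergent_def)
  have S_le: "?S N \<le> L" for N
    using L sum_J_mono by (intro incseq_le) (auto simp: incseq_def)
  have "0 \<le> L" using S_le[of 0] by (simp add: J_def)
  obtain r where lim: "AE z in \<rho> \<Otimes>\<^sub>M P. (\<lambda>n. R (r n) (fst z) (snd z)) \<longlonglongrightarrow> 0"
    using ex_residual_subseq by blast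
  have V: "V (J N) \<in> l2 (\<rho> \<Otimes>\<^sub>M P)" for N by (intro V_l2) (auto dest: J_subset)
  note [measurable] = l2D(1)[OF V]
  have int: "integrable (\<rho> \<Otimes>\<^sub>M P) (\<lambda>z. (cmod (G (fst z) (snd z)))\<^sup>2)"
    using l2D(2)[OF field_l2_pair] by (simp add: split_def)
  have "ennreal trace = ennreal (\<integral>z. (cmod (G (fst z) (snd z)))\<^sup>2 \<partial>(\<rho> \<Otimes>\<^sub>M P))"
    using integral_fst'[OF int] by (simp add: trace_def Re_cov_kernel_diag)
  also have "\<dots> = (\<integral>\<^sup>+z. ennreal ((cmod (G (fst z) (snd z)))\<^sup>2) \<partial>(\<rho> \<Otimes>\<^sub>M P))"
    by (rule nn_integral_eq_integral[symmetric, OF int]) simp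
  also have "\<dots> \<le> ennreal L"
  proof (rule nn_integral_le_of_tendsto[where f = "\<lambda>n z. (cmod (V (J (r n)) z))\<^sup>2"])
    show "AE z in \<rho> \<Otimes>\<^sub>M P. (\<lambda>n. (cmod (V (J (r n)) z))\<^sup>2) \<longlonglongrightarrow> (cmod (G (fst z) (snd z)))\<^sup>2"
      using lim
    proof eventually_elim
      fix z assume "(\<lambda>n. R (r n) (fst z) (snd z)) \<longlonglongrightarrow> 0"
      from tendsto_diff[OF tendsto_const[of "G (fst z) (snd z)"] this]
      have "(\<lambda>n. V (J (r n)) z) \<longlonglongrightarrow> G (fst z) (snd z)"
        by (simp add: R_def V_def split_def)
      then show "(\<lambda>n. (cmod (V (J (r n)) z))\<^sup>2) \<longlonglongrightarrow> (cmod (G (fst z) (snd z)))\<^sup>2"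
        by (intro tendsto_power tendsto_norm)
    qed
    fix n
    have "(\<integral>\<^sup>+z. ennreal ((cmod (V (J (r n)) z))\<^sup>2) \<partial>(\<rho> \<Otimes>\<^sub>M P)) = ennreal (?S (r n))"
      using l2D(2)[OF V] by (subst nn_integral_eq_integral) (auto simp: integral_norm_V J_subset subset_iff)
    then show "(\<integral>\<^sup>+z. ennreal ((cmod (V (J (r n)) z))\<^sup>2) \<partial>(\<rho> \<Otimes>\<^sub>M P)) \<le> ennreal L"
      using S_le by (simp add: ennreal_leI)
  qed measurable
  finally have "trace \<le> L" using \<open>0 \<le> L\<close> by (simp add: ennreal_le_iff)
  moreover have "L \<le> trace" by (rule LIMSEQ_le_const2[OF L]) (auto intro: sum_J_le_trace)
  ultimately show ?thesis using L by simp
qed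

section \<open>Pointwise convergence outside a null set\<close>

lemma AE_Re_KN_diag_tendsto: "AE t in \<rho>. (\<lambda>N. Re (KN N t t)) \<longlonglongrightarrow> Re (K t t)"
proof -
  let ?S = "\<lambda>N. \<Sum>i\<in>J N. \<alpha> i"
  \<comment> \<open>At good points this is the variance of the residual: nonnegative and decreasing
    in N. Its integral tends to 0 by the trace formula, so its pointwise limit H is 0 almost
    everywhere.\<close>
  define h where "h N t = Re (K t t) - Re (KN N t t)" for N t
  define H where "H t = lim (\<lambda>N. h N t)" for t
  have h_int: "integrable \<rho> (h N)" and h_val: "(\<integral>t. h N t \<partial>\<rho>) = trace - ?S N" for N
    using integrable_variance integrable_Re_KN_diag[of N] integral_Re_KN_diag[of N]
    by (simp_all add: h_def[abs_def] trace_def)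
  have [measurable]: "h N \<in> borel_measurable \<rho>" for N
    using h_int by (rule borel_measurable_integrable)
  have [measurable]: "H \<in> borel_measurable \<rho>"
    unfolding H_def[abs_def] by measurable
  have h_nonneg: "AE t in \<rho>. 0 \<le> h N t" for N
    using AE_good by eventually_elim (simp add: h_def Re_KN_diag_le)
  have lim: "AE t in \<rho>. (\<lambda>N. h N t) \<longlonglongrightarrow> H t \<and> 0 \<le> H t"
    using AE_good
  proof eventually_elim
    fix t assume t: "good t"
    obtain l where "(\<lambda>N. Re (KN N t t)) \<longlonglongrightarrow> l"
      using incseq_convergent[of "\<lambda>N. Re (KN N t t)" "Re (K t t)"] Re_KN_diag_le[OF t] Re_KN_diag_mono
      by (metis incseq_def)
    from tendsto_diff[OF tendsto_const[of "Re (K t t)"] this]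
    have "convergent (\<lambda>N. h N t)"
      unfolding h_def by (rule convergentI)
    then have "(\<lambda>N. h N t) \<longlonglongrightarrow> H t" by (simp add: H_def convergent_LIMSEQ_iff)
    moreover from this have "0 \<le> H t"
      by (rule LIMSEQ_le_const) (auto simp: h_def Re_KN_diag_le[OF t])
    ultimately show "(\<lambda>N. h N t) \<longlonglongrightarrow> H t \<and> 0 \<le> H t" by simp
  qed
  have "(\<integral>\<^sup>+t. ennreal (H t) \<partial>\<rho>) \<le> ennreal (trace - ?S N)" for N
  \<comment> \<open>The shift by N makes every integral in the sequence at most the one for N, so H
    inherits that bound for each N.\<close>
  proof (rule nn_integral_le_of_tendsto[where f = "\<lambda>n. h (n + N)"])
    show "AE t in \<rho>. (\<lambda>n. h (n + N) t) \<longlonglongrightarrow> H t"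
      using lim by eventually_elim (intro LIMSEQ_ignore_initial_segment, simp)
    fix n
    have "(\<integral>\<^sup>+t. ennreal (h (n + N) t) \<partial>\<rho>) = ennreal (trace - ?S (n + N))"
      using nn_integral_eq_integral[OF h_int h_nonneg] by (simp add: h_val)
    also have "\<dots> \<le> ennreal (trace - ?S N)"
      using sum_J_mono[of N "n + N"] by (intro ennreal_leI) simp
    finally show "(\<integral>\<^sup>+t. ennreal (h (n + N) t) \<partial>\<rho>) \<le> ennreal (trace - ?S N)" .
  qed measurable
  moreover have "(\<lambda>N. ennreal (trace - ?S N)) \<longlonglongrightarrow> 0"
    using tendsto_ennrealI[OF tendsto_diff[OF tendsto_const[of trace] sum_J_tendsto_trace]] by simp
  ultimately have "(\<integral>\<^sup>+t. ennreal (H t) \<partial>\<rho>) \<le> 0"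
    by (intro LIMSEQ_le_const) auto
  then have "AE t in \<rho>. ennreal (H t) = 0"
    by (subst nn_integral_0_iff_AE[symmetric]) auto
  with lim show ?thesis
  proof eventually_elim
    fix t assume "(\<lambda>N. h N t) \<longlonglongrightarrow> H t \<and> 0 \<le> H t" "ennreal (H t) = 0"
    then have "(\<lambda>N. h N t) \<longlonglongrightarrow> 0" by (auto simp: ennreal_eq_0_iff)
    from tendsto_diff[OF tendsto_const[of "Re (K t t)"] this]
    show "(\<lambda>N. Re (KN N t t)) \<longlonglongrightarrow> Re (K t t)" by (simp add: h_def)
  qed
qed

text \<open>A condition on one point passes to finite powers of \<rho> coordinate by coordinate, and
  it treats k = 1, where both arguments of K coincide, like every other k.\<close>

definition nice :: "'a \<Rightarrow> bool" where
  "nice t \<longleftrightarrow> good t \<and> (\<lambda>N. Re (KN N t t)) \<longlonglongrightarrow> Re (K t t)"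

lemma AE_nice: "AE t in \<rho>. nice t"
  using AE_good AE_Re_KN_diag_tendsto by eventually_elim (simp add: nice_def)

lemma KN_tendsto:
  assumes "nice s" "nice t"
  shows "(\<lambda>N. KN N s t) \<longlonglongrightarrow> K s t"
proof -
  have "(\<lambda>N. K s t - KN N s t) \<longlonglongrightarrow> 0"
  proof (rule Lim_null_comparison)
    show "\<forall>\<^sub>F N in sequentially. norm (K s t - KN N s t)
        \<le> sqrt (Re (K s s) - Re (KN N s s)) * sqrt (Re (K t t) - Re (KN N t t))"
      using assms by (intro always_eventually allI norm_residual_kernel_le) (auto simp: nice_def)
    have "(\<lambda>N. sqrt (Re (K x x) - Re (KN N x x))) \<longlonglongrightarrow> sqrt (Re (K x x) - Re (K x x))" if "nice x" for x
      using that by (intro tendsto_real_sqrt tendsto_diff tendsto_const) (simp add: nice_def)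
    from tendsto_mult[OF this[OF assms(1)] this[OF assms(2)]]
    show "(\<lambda>N. sqrt (Re (K s s) - Re (KN N s s)) * sqrt (Re (K t t) - Re (KN N t t))) \<longlonglongrightarrow> 0"
      by simp
  qed
  from tendsto_diff[OF tendsto_const[of "K s t"] this] show ?thesis by simp
qed

text \<open>The factor 2 comes from writing K_N as K - (K - K_N) and bounding both terms alike; any
  constant free of N serves as well for domination.\<close>

lemma norm_KN_le:
  assumes "nice s" "nice t"
  shows "cmod (KN N s t) \<le> 2 * (sqrt (Re (K s s)) * sqrt (Re (K t t)))"
  using norm_residual_kernel_le'[of s t N] norm_cov_kernel_le[of s t] assms
    norm_triangle_ineq4[of "K s t" "K s t - KN N s t"]
  by (simp add: nice_def)

end

section \<open>Cyclic products\<close>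

text \<open>A cylinder over a null set is null even when the other factors have infinite measure,
  since 0 times infinity is 0 in \<open>ennreal\<close>.\<close>

lemma (in product_sigma_finite) AE_PiM_component:
  assumes I: "finite I" "i \<in> I" and Q: "AE x in M i. Q x"
  shows "AE t in Pi\<^sub>M I M. Q (t i)"
proof -
  from Q obtain A where A: "{x \<in> space (M i). \<not> Q x} \<subseteq> A" "emeasure (M i) A = 0" "A \<in> sets (M i)"
    by (rule AE_E)
  let ?B = "\<lambda>j. if j = i then A else space (M j)"
  have B: "?B j \<in> sets (M j)" for j using A by auto
  have "emeasure (Pi\<^sub>M I M) (Pi\<^sub>E I ?B) = (\<Prod>j\<in>I. emeasure (M j) (?B j))"
    using I B by (intro emeasure_PiM) auto
  also have "\<dots> = 0" using I A by (intro prod_zero bexI[of _ i]) auto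
  finally show ?thesis
    using A B I by (intro AE_I[where N = "Pi\<^sub>E I ?B"])
      (auto simp: space_PiM PiE_iff extensional_def split: if_splits intro!: sets_PiM_I_finite)
qed

text \<open>Predecessor in the cycle 1, ..., k. The wrap-around from 1 to k accounts for the closing
  factor K(t 1, t k); for k = 1 the point 1 is its own predecessor.\<close>

definition cyc_pred :: "nat \<Rightarrow> nat \<Rightarrow> nat" where
  "cyc_pred k j = (if j = 1 then k else j - 1)"

definition cyc_suc :: "nat \<Rightarrow> nat \<Rightarrow> nat" where
  "cyc_suc k j = (if j = k then 1 else Suc j)"

lemma cyc_pred_suc: "j \<in> {1..k} \<Longrightarrow> cyc_pred k (cyc_suc k j) = j"
  by (auto simp: cyc_pred_def cyc_suc_def)

lemma cyc_pred_mem: "j \<in> {1..k} \<Longrightarrow> cyc_pred k j \<in> {1..k}"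
  by (auto simp: cyc_pred_def)

lemma cyc_suc_mem: "j \<in> {1..k} \<Longrightarrow> cyc_suc k j \<in> {1..k}"
  by (auto simp: cyc_suc_def)

lemma bij_cyc_pred: "bij_betw (cyc_pred k) {1..k} {1..k}"
  by (rule bij_betw_byWitness[where f' = "cyc_suc k"])
    (auto simp: cyc_pred_def cyc_suc_def)

lemma bij_cyc_suc: "bij_betw (cyc_suc k) {1..k} {1..k}"
  by (rule bij_betw_byWitness[where f' = "cyc_pred k"])
    (auto simp: cyc_pred_def cyc_suc_def)

text \<open>The involution j -> k - j + 1 reverses the given order of the factors, and the closing
  factor becomes the one for j = 1. For k = 0 the left side still has its closing factor, while the
  right side is empty.\<close>

lemma cyclic_kernel_product_eq:
  assumes "1 \<le> k"
  shows "cyclic_kernel_product K k t = (\<Prod>j\<in>{1..k}. K (t j) (t (cyc_pred k j)))"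
proof -
  have "(\<Prod>j\<in>{1..k-1}. K (t (k - j + 1)) (t (k - j))) = (\<Prod>j\<in>{2..k}. K (t j) (t (cyc_pred k j)))"
    by (rule prod.reindex_bij_witness[where i = "\<lambda>j. k - j + 1" and j = "\<lambda>j. k - j + 1"])
      (auto simp: cyc_pred_def)
  moreover have "{1..k} = insert 1 {2..k}" using assms by auto
  ultimately show ?thesis
    by (simp add: cyclic_kernel_product_def cyc_pred_def mult.commute)
qed

lemma cyclically_constant:
  assumes suc: "\<And>j. j \<in> {1..k} \<Longrightarrow> f j = f (cyc_suc k j)" and "j \<in> {1..k}"
  shows "f j = f 1"
proof -
  have "Suc m \<le> k \<Longrightarrow> f (Suc m) = f 1" for m
  proof (induction m)
    case (Suc m)
    have "f (Suc m) = f (cyc_suc k (Suc m))"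
      by (rule suc) (use Suc.prems in auto)
    also have "cyc_suc k (Suc m) = Suc (Suc m)"
      using Suc.prems by (simp add: cyc_suc_def)
    finally show ?case using Suc.IH Suc.prems by simp
  qed simp
  from this[of "j - 1"] show ?thesis using assms(2) by simp
qed

lemma sum_cyclic_PiE:
  fixes \<alpha> :: "nat \<Rightarrow> 'c::comm_semiring_1"
  assumes "1 \<le> k" and "finite F"
  shows "(\<Sum>f\<in>PiE {1..k} (\<lambda>_. F). \<Prod>j\<in>{1..k}. if f j = f (cyc_suc k j) then \<alpha> (f j) else 0)
    = (\<Sum>i\<in>F. \<alpha> i ^ k)"
proof -
  \<comment> \<open>\<open>PiE\<close> contains only functions that are undefined off {1..k}, hence
    the restriction of the constant tuples.\<close>
  let ?c = "\<lambda>i. restrict (\<lambda>_. i) {1..k}"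
  let ?T = "\<lambda>f. \<Prod>j\<in>{1..k}. if f j = f (cyc_suc k j) then \<alpha> (f j) else 0"
  have inj: "inj_on ?c F"
  proof (rule inj_onI)
    fix x y assume "?c x = ?c y"
    then have "?c x 1 = ?c y 1" by simp
    then show "x = y" using assms by simp
  qed
  have "(\<Sum>f\<in>PiE {1..k} (\<lambda>_. F). ?T f) = (\<Sum>f\<in>?c ` F. ?T f)"
  proof (rule sum.mono_neutral_right)
    show "finite (PiE {1..k} (\<lambda>_. F))" using assms by (intro finite_PiE) auto
    show "?c ` F \<subseteq> PiE {1..k} (\<lambda>_. F)" by auto
    show "\<forall>f\<in>PiE {1..k} (\<lambda>_. F) - ?c ` F. ?T f = 0"
    proof
      fix f assume f: "f \<in> PiE {1..k} (\<lambda>_. F) - ?c ` F"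
      have "\<exists>j\<in>{1..k}. f j \<noteq> f (cyc_suc k j)"
      proof (rule ccontr)
        assume "\<not> (\<exists>j\<in>{1..k}. f j \<noteq> f (cyc_suc k j))"
        then have suc: "f j = f (cyc_suc k j)" if "j \<in> {1..k}" for j
          using that by simp
        have const: "f j = f 1" if "j \<in> {1..k}" for j
          using suc that by (rule cyclically_constant[where f = f])
        have "f 1 \<in> F" using f assms(1) by (intro PiE_mem[of f "{1..k}" "\<lambda>_. F"]) auto
        moreover have "f = ?c (f 1)"
        proof
          fix j
          show "f j = ?c (f 1) j"
            using const[of j] PiE_arb[of f "{1..k}" "\<lambda>_. F" j] f by (cases "j \<in> {1..k}") auto
        qed
        ultimately show False using f by blast
      qed
      then obtain j where j: "j \<in> {1..k}" "f j \<noteq> f (cyc_suc k j)" by blast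
      show "?T f = 0"
        by (rule prod_zero) (use j in \<open>auto intro!: bexI[of _ j]\<close>)
    qed
  qed
  also have "\<dots> = (\<Sum>i\<in>F. ?T (?c i))"
    unfolding sum.reindex[OF inj] comp_def ..
  also have "\<dots> = (\<Sum>i\<in>F. \<alpha> i ^ k)"
  proof (rule sum.cong[OF refl])
    fix i
    have "?T (?c i) = (\<Prod>j\<in>{1..k}. \<alpha> i)"
      using cyc_suc_mem[of _ k] by (intro prod.cong refl) auto
    then show "?T (?c i) = \<alpha> i ^ k" by simp
  qed
  finally show ?thesis .
qed

section \<open>Cyclic integrals of finite rank and their limit\<close>

context mercer_field
begin

sublocale power: product_sigma_finite "\<lambda>_::nat. \<rho>" ..

lemma AE_nice_PiM: "AE t in (\<Pi>\<^sub>M j\<in>{1..k}. \<rho>). \<forall>j\<in>{1..k::nat}. nice (t j)"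
  by (intro AE_finite_allI power.AE_PiM_component AE_nice) auto

text \<open>Expanded over index tuples f, the j-th factor involves t j and its predecessor. Moving
  the conjugated factors one step around the cycle collects everything that depends on t j, so the
  integral splits into the inner products of e (f j) with e (f (cyc_suc k j)).\<close>

lemma integral_cyclic_KN:
  assumes k: "1 \<le> k"
  shows "(\<integral>t. cyclic_kernel_product (KN N) k t \<partial>(\<Pi>\<^sub>M j\<in>{1..k}. \<rho>)) = complex_of_real (\<Sum>i\<in>J N. \<alpha> i ^ k)"
proof -
  let ?PM = "\<Pi>\<^sub>M j\<in>{1..k}. \<rho>" and ?X = "PiE {1..k} (\<lambda>_. J N)"
  let ?g = "\<lambda>f j s. complex_of_real (\<alpha> (f j)) * (e (f j) s * cnj (e (f (cyc_suc k j)) s))"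
  have mem: "f j \<in> I" "f (cyc_suc k j) \<in> I" if "f \<in> ?X" "j \<in> {1..k}" for f j
    using PiE_mem[OF that(1)] that(2) cyc_suc_mem J_subset by blast+
  have int: "integrable \<rho> (?g f j)" if "f \<in> ?X" "j \<in> {1..k}" for f j
    using mem[OF that] by (intro integrable_mult_right integrable_mult_cnj_l2 e_l2)
  have val: "(\<integral>s. ?g f j s \<partial>\<rho>) = (if f j = f (cyc_suc k j) then complex_of_real (\<alpha> (f j)) else 0)"
    if "f \<in> ?X" "j \<in> {1..k}" for f j
    using inner_e[OF mem[OF that]] by (simp add: l2_inner_def)
  have expand: "cyclic_kernel_product (KN N) k t = (\<Sum>f\<in>?X. \<Prod>j\<in>{1..k}. ?g f j (t j))" for t
  proof -
    have "cyclic_kernel_product (KN N) k t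
      = (\<Sum>f\<in>?X. \<Prod>j\<in>{1..k}. complex_of_real (\<alpha> (f j)) * e (f j) (t j) * cnj (e (f j) (t (cyc_pred k j))))"
      unfolding cyclic_kernel_product_eq[OF k] KN_def by (rule prod_sum_PiE) auto
    also have "\<dots> = (\<Sum>f\<in>?X. \<Prod>j\<in>{1..k}. ?g f j (t j))"
    proof (rule sum.cong[OF refl])
      fix f
      have "(\<Prod>j\<in>{1..k}. cnj (e (f j) (t (cyc_pred k j))))
        = (\<Prod>j\<in>{1..k}. cnj (e (f (cyc_suc k j)) (t (cyc_pred k (cyc_suc k j)))))"
        by (rule prod.reindex_bij_betw[OF bij_cyc_suc, symmetric])
      also have "\<dots> = (\<Prod>j\<in>{1..k}. cnj (e (f (cyc_suc k j)) (t j)))"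
        by (intro prod.cong refl) (simp add: cyc_pred_suc)
      finally show "(\<Prod>j\<in>{1..k}. complex_of_real (\<alpha> (f j)) * e (f j) (t j) * cnj (e (f j) (t (cyc_pred k j))))
        = (\<Prod>j\<in>{1..k}. ?g f j (t j))"
        by (simp add: prod.distrib mult.assoc)
    qed
    finally show ?thesis .
  qed
  have "(\<integral>t. cyclic_kernel_product (KN N) k t \<partial>?PM) = (\<Sum>f\<in>?X. \<integral>t. (\<Prod>j\<in>{1..k}. ?g f j (t j)) \<partial>?PM)"
    unfolding expand
    by (intro Bochner_Integration.integral_sum power.product_integrable_prod int) auto
  also have "\<dots> = (\<Sum>f\<in>?X. \<Prod>j\<in>{1..k}. \<integral>s. ?g f j s \<partial>\<rho>)"
    by (intro sum.cong refl power.product_integral_prod int) auto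
  also have "\<dots> = (\<Sum>f\<in>?X. \<Prod>j\<in>{1..k}. if f j = f (cyc_suc k j) then complex_of_real (\<alpha> (f j)) else 0)"
    by (intro sum.cong prod.cong refl val)
  also have "\<dots> = (\<Sum>i\<in>J N. complex_of_real (\<alpha> i) ^ k)"
    by (rule sum_cyclic_PiE) (use k in auto)
  finally show ?thesis by simp
qed

text \<open>Around the cycle every root of K(t j, t j) occurs twice, once for t j itself and once as
  predecessor. The roots recombine, and the majorant is a product of functions of one variable,
  integrable by the variance hypothesis.\<close>

lemma prod_cyclic_bound:
  assumes "\<And>j. j \<in> {1..k} \<Longrightarrow> cmod (L (t j) (t (cyc_pred k j)))
    \<le> 2 * (sqrt (Re (K (t j) (t j))) * sqrt (Re (K (t (cyc_pred k j)) (t (cyc_pred k j)))))"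
  shows "cmod (\<Prod>j\<in>{1..k}. L (t j) (t (cyc_pred k j))) \<le> (\<Prod>j\<in>{1..k}. 2 * Re (K (t j) (t j)))"
proof -
  let ?q = "\<lambda>j. sqrt (Re (K (t j) (t j)))"
  have "cmod (\<Prod>j\<in>{1..k}. L (t j) (t (cyc_pred k j))) \<le> (\<Prod>j\<in>{1..k}. 2 * (?q j * ?q (cyc_pred k j)))"
    unfolding prod_norm[symmetric] by (rule prod_mono) (use assms in auto)
  also have "\<dots> = (\<Prod>j\<in>{1..k}. 2 * ?q j) * (\<Prod>j\<in>{1..k}. ?q (cyc_pred k j))"
    by (simp add: prod.distrib mult.assoc)
  also have "(\<Prod>j\<in>{1..k}. ?q (cyc_pred k j)) = (\<Prod>j\<in>{1..k}. ?q j)"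
    by (rule prod.reindex_bij_betw[OF bij_cyc_pred])
  also have "(\<Prod>j\<in>{1..k}. 2 * ?q j) * (\<Prod>j\<in>{1..k}. ?q j) = (\<Prod>j\<in>{1..k}. 2 * Re (K (t j) (t j)))"
    by (simp add: prod.distrib[symmetric] variance_nonneg mult.assoc)
  finally show ?thesis .
qed

lemma cyclic_moments:
  assumes k: "1 \<le> k"
  shows "integrable (\<Pi>\<^sub>M j\<in>{1..k}. \<rho>) (cyclic_kernel_product K k)"
    and "(\<lambda>N. complex_of_real (\<Sum>i\<in>J N. \<alpha> i ^ k))
      \<longlonglongrightarrow> (\<integral>t. cyclic_kernel_product K k t \<partial>(\<Pi>\<^sub>M j\<in>{1..k}. \<rho>))"
proof -
  let ?PM = "\<Pi>\<^sub>M j\<in>{1..k}. \<rho>"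
  let ?B = "\<lambda>t. \<Prod>j\<in>{1..k}. 2 * Re (K (t j) (t j))"
  have B: "integrable ?PM ?B"
    using integrable_variance by (intro power.product_integrable_prod) auto
  have comp: "(\<lambda>t. t j) \<in> measurable ?PM \<rho>" "(\<lambda>t. t (cyc_pred k j)) \<in> measurable ?PM \<rho>"
    if "j \<in> {1..k}" for j
    using measurable_component_singleton[OF that] measurable_component_singleton[OF cyc_pred_mem[OF that]]
    by simp_all
  have mK: "cyclic_kernel_product K k \<in> borel_measurable ?PM"
    unfolding cyclic_kernel_product_eq[OF k, abs_def]
    by (intro borel_measurable_prod measurable_cov_kernel_compose comp)
  have mKN: "cyclic_kernel_product (KN N) k \<in> borel_measurable ?PM" for N
    unfolding cyclic_kernel_product_eq[OF k, abs_def]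
    by (intro borel_measurable_prod measurable_KN comp)
  have lim: "AE t in ?PM. (\<lambda>N. cyclic_kernel_product (KN N) k t) \<longlonglongrightarrow> cyclic_kernel_product K k t"
    using AE_nice_PiM[of k]
  proof eventually_elim
    fix t :: "nat \<Rightarrow> 'a" assume t: "\<forall>j\<in>{1..k}. nice (t j)"
    have "nice (t (cyc_pred k j))" if "j \<in> {1..k}" for j
      using t cyc_pred_mem[OF that] by blast
    then show "(\<lambda>N. cyclic_kernel_product (KN N) k t) \<longlonglongrightarrow> cyclic_kernel_product K k t"
      unfolding cyclic_kernel_product_eq[OF k] using t by (intro tendsto_prod KN_tendsto) auto
  qed
  have bound: "AE t in ?PM. norm (cyclic_kernel_product (KN N) k t) \<le> ?B t" for N
    using AE_nice_PiM[of k]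
  proof eventually_elim
    fix t :: "nat \<Rightarrow> 'a" assume t: "\<forall>j\<in>{1..k}. nice (t j)"
    have "nice (t (cyc_pred k j))" if "j \<in> {1..k}" for j
      using t cyc_pred_mem[OF that] by blast
    then show "norm (cyclic_kernel_product (KN N) k t) \<le> ?B t"
      unfolding cyclic_kernel_product_eq[OF k] using t by (intro prod_cyclic_bound norm_KN_le) auto
  qed
  show "integrable ?PM (cyclic_kernel_product K k)"
    by (rule integrable_dominated_convergence[OF mK mKN B lim bound])
  have "(\<lambda>N. \<integral>t. cyclic_kernel_product (KN N) k t \<partial>?PM) \<longlonglongrightarrow> (\<integral>t. cyclic_kernel_product K k t \<partial>?PM)"
    by (rule integral_dominated_convergence[OF mK mKN B lim bound])
  then show "(\<lambda>N. complex_of_real (\<Sum>i\<in>J N. \<alpha> i ^ k)) \<longlonglongrightarrow> (\<integral>t. cyclic_kernel_product K k t \<partial>?PM)"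
    by (simp only: integral_cyclic_KN[OF k])
qed

lemma eigen_power_sum_eq:
  assumes k: "1 \<le> k"
  shows "eigen_power_sum I \<alpha> k < \<infinity>"
    and "complex_of_real (enn2real (eigen_power_sum I \<alpha> k))
      = (\<integral>t. cyclic_kernel_product K k t \<partial>(\<Pi>\<^sub>M j\<in>{1..k}. \<rho>))"
proof -
  let ?L = "\<integral>t. cyclic_kernel_product K k t \<partial>(\<Pi>\<^sub>M j\<in>{1..k}. \<rho>)"
  let ?S = "\<lambda>N. \<Sum>i\<in>J N. \<alpha> i ^ k"
  have nonneg: "0 \<le> \<alpha> i ^ k" if "i \<in> I" for i
    using eigenvalue_pos[OF that] by simp
  have lim: "?S \<longlonglongrightarrow> Re ?L"
    using tendsto_Re[OF cyclic_moments(2)[OF k]] by simp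
  \<comment> \<open>A limit of real numbers, so the imaginary part of the integral vanishes.\<close>
  have real: "complex_of_real (Re ?L) = ?L"
    using LIMSEQ_unique[OF tendsto_of_real[OF lim] cyclic_moments(2)[OF k]] .
  have "0 \<le> Re ?L"
    by (rule LIMSEQ_le_const[OF lim]) (auto intro!: sum_nonneg nonneg dest: J_subset)
  \<comment> \<open>In \<open>ennreal\<close> every family is summable, so the sum is a limit of
    partial sums before its finiteness is known; finiteness then comes from the limit being the real
    number Re ?L.\<close>
  have "((\<lambda>i. ennreal (\<alpha> i ^ k)) has_sum eigen_power_sum I \<alpha> k) I"
    unfolding eigen_power_sum_def by (intro has_sum_infsum nonneg_summable_on_complete) simp
  then have "((\<lambda>i. if i \<in> I then ennreal (\<alpha> i ^ k) else 0) has_sum eigen_power_sum I \<alpha> k) UNIV"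
    by (rule has_sum_cong_neutral[THEN iffD1, rotated -1]) auto
  then have "(\<lambda>N. \<Sum>i<N. if i \<in> I then ennreal (\<alpha> i ^ k) else 0) \<longlonglongrightarrow> eigen_power_sum I \<alpha> k"
    using has_sum_imp_sums unfolding sums_def by blast
  moreover have "(\<Sum>i<N. if i \<in> I then ennreal (\<alpha> i ^ k) else 0) = ennreal (?S N)" for N
  proof -
    have "(\<Sum>i<N. if i \<in> I then ennreal (\<alpha> i ^ k) else 0) = (\<Sum>i\<in>J N. ennreal (\<alpha> i ^ k))"
      unfolding J_def by (subst sum.inter_restrict[symmetric]) (auto intro: sum.cong)
    then show ?thesis by (simp add: sum_ennreal nonneg J_subset)
  qed
  ultimately have "eigen_power_sum I \<alpha> k = ennreal (Re ?L)"
    using LIMSEQ_unique tendsto_ennrealI[OF lim] by simp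
  then show "eigen_power_sum I \<alpha> k < \<infinity>" "complex_of_real (enn2real (eigen_power_sum I \<alpha> k)) = ?L"
    using \<open>0 \<le> Re ?L\<close> real by simp_all
qed

end

theorem proposition3p8:
  fixes \<rho> :: "(real ^ 'd) measure"
    and P :: "'w measure"
    and G :: "real ^ 'd \<Rightarrow> 'w \<Rightarrow> complex"
    and K :: "real ^ 'd \<Rightarrow> real ^ 'd \<Rightarrow> complex"
    and I :: "nat set"
    and \<alpha> :: "nat \<Rightarrow> real"
    and e :: "nat \<Rightarrow> real ^ 'd \<Rightarrow> complex"
  assumes "sets \<rho> = sets borel"
    and "sigma_finite_measure \<rho>"
    and "symmetric_measure \<rho>"
    and "prob_space P"
    and "second_order_field P G"
    and "measurable_field P G"
    and "centered_field P G"
    and "hermitian_field P G"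
    and "K = cov_kernel P G"
    and "(\<integral>\<^sup>+t. ennreal (Re (K t t)) \<partial>\<rho>) < \<infinity>"
    and "mercer_representation \<rho> K I \<alpha> e"
  shows "(\<forall>k\<ge>1.
            integrable (\<Pi>\<^sub>M j\<in>{1..k}. \<rho>) (cyclic_kernel_product K k) \<and>
            eigen_power_sum I \<alpha> k < \<infinity> \<and>
            complex_of_real (enn2real (eigen_power_sum I \<alpha> k)) =
              (\<integral>t. cyclic_kernel_product K k t \<partial>(\<Pi>\<^sub>M j\<in>{1..k}. \<rho>))) \<and>
         (eigen_power_sum I \<alpha> 1 < \<infinity> \<longrightarrow> (\<forall>k\<ge>1. eigen_power_sum I \<alpha> k < \<infinity>))"
proof -
  interpret \<rho>: sigma_finite_measure \<rho> by fact
  interpret P: prob_space P by fact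
  have sets [measurable_cong]: "sets (\<rho> \<Otimes>\<^sub>M P) = sets (borel \<Otimes>\<^sub>M P)"
    using assms(1) by (intro sets_pair_measure_cong refl)
  have G [measurable]: "(\<lambda>(t, \<omega>). G t \<omega>) \<in> borel_measurable (\<rho> \<Otimes>\<^sub>M P)"
    using assms(6) unfolding measurable_field_def by (simp add: measurable_cong_sets[OF sets refl])
  have var: "Re (cov_kernel P G t t) = (\<integral>\<omega>. (cmod (G t \<omega>))\<^sup>2 \<partial>P)" for t
    using l2_inner_self[of P "G t"] by (simp add: l2_inner_def cov_kernel_def)
  have "integrable \<rho> (\<lambda>t. Re (cov_kernel P G t t))"
  proof (rule integrableI_bounded)
    show "(\<lambda>t. Re (cov_kernel P G t t)) \<in> borel_measurable \<rho>"
      unfolding var by measurable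
    \<comment> \<open>\<open>ennreal\<close> would cut negative values off; by \<open>var\<close>
      the real part of K(t, t) is a second moment, so it equals its modulus and nothing is
      lost.\<close>
    show "(\<integral>\<^sup>+t. ennreal (norm (Re (cov_kernel P G t t))) \<partial>\<rho>) < \<infinity>"
      using assms(10) unfolding assms(9) by (simp add: var)
  qed
  then interpret mercer_field \<rho> P G I \<alpha> e
    using assms(5,11) G unfolding assms(9)
    by unfold_locales (auto simp: second_order_field_def mercer_representation_def)
  show ?thesis
    using cyclic_moments(1) eigen_power_sum_eq by (auto simp: assms(9))
qed

end
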